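(* There exist linear maps $T_1\colon M_3(\mathbb{C})\to OH(\{1,2,3\})$ and $T_2\colon l^\infty(\{1,\ldots,4\})\to OH(\{1,2\})$ such that $$\|T_i\|_{\mathrm{cb}}<C(T_i),\qquad i=1,2.$$ In particular, the best constant $C_0$ in the noncommutative little Grothendieck inequality, i.e. the smallest constant $C_0$ for which $C(T)\leq C_0\|T\|_{\mathrm{cb}}$ for all $C^*$-algebras $A$, all index sets $I$ and all completely bounded maps $T\colon A\to OH(I)$, is strictly larger than $1$.
   Context: $OH(I)$ is Pisier's operator Hilbert space based on $l^2(I)$: with $(e_i)_{i\in I}$ the standard orthonormal basis, its operator space structure is determined by $\big\|\sum_i e_i\otimes x_i\big\|_{M_n(OH(I))}=\big\|\sum_i x_i\otimes\overline{x_i}\big\|^{1/2}_{M_n(\mathbb{C})\otimes\overline{M_n(\mathbb{C})}}$ for finitely supported families $(x_i)$ in $M_n(\mathbb{C})$. For a $C^*$-algebra $A$ and a completely bounded map $T\colon A\to OH(I)$, $C(T)$ denotes the smallest constant $C>0$ for which there exist states $f_1,f_2$ on $A$ such that $\|Tx\|\leq C f_1(xx^* )^{1/4}f_2(x^*x)^{1/4}$ for all $x\in A$. (It is known that $\|T\|_{\mathrm{cb}}\leq C(T)\leq\sqrt{2}\,\|T\|_{\mathrm{cb}}$; the right-hand inequality is the noncommutative little Grothendieck inequality.) *)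

theory Defs
  imports "HOL-Analysis.Analysis" "HOL-Algebra.Module"
begin

section \<open>C*-algebras\<close>

text \<open>
  The algebra is carried by a set, not by a type, so that one can quantify over all C*-algebras
  with carrier in a given type. C*-algebras are not assumed unital: the field \<open>one\<close>, inherited
  from the ring records, is subject to no axiom and plays no role.
\<close>

record 'a cstar = "(complex, 'a) module" +
  star :: "'a \<Rightarrow> 'a"
  nrm :: "'a \<Rightarrow> real"

definition complex_ring :: "complex ring" where
  "complex_ring = \<lparr>carrier = UNIV, monoid.mult = (*), one = 1, ring.zero = 0, add = (+)\<rparr>"

locale cstar_algebra = module complex_ring A for A :: "'a cstar" (structure) +
  assumes mult_closed: "\<lbrakk>x \<in> carrier A; y \<in> carrier A\<rbrakk> \<Longrightarrow> x \<otimes> y \<in> carrier A"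
    and mult_assoc: "\<lbrakk>x \<in> carrier A; y \<in> carrier A; z \<in> carrier A\<rbrakk>
          \<Longrightarrow> (x \<otimes> y) \<otimes> z = x \<otimes> (y \<otimes> z)"
    and distrib_right: "\<lbrakk>x \<in> carrier A; y \<in> carrier A; z \<in> carrier A\<rbrakk>
          \<Longrightarrow> (x \<oplus> y) \<otimes> z = x \<otimes> z \<oplus> y \<otimes> z"
    and distrib_left: "\<lbrakk>x \<in> carrier A; y \<in> carrier A; z \<in> carrier A\<rbrakk>
          \<Longrightarrow> z \<otimes> (x \<oplus> y) = z \<otimes> x \<oplus> z \<otimes> y"
    and smult_mult_left: "\<lbrakk>x \<in> carrier A; y \<in> carrier A\<rbrakk> \<Longrightarrow> (c \<odot> x) \<otimes> y = c \<odot> (x \<otimes> y)"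
    and smult_mult_right: "\<lbrakk>x \<in> carrier A; y \<in> carrier A\<rbrakk> \<Longrightarrow> x \<otimes> (c \<odot> y) = c \<odot> (x \<otimes> y)"
    and star_closed: "x \<in> carrier A \<Longrightarrow> star A x \<in> carrier A"
    and star_star: "x \<in> carrier A \<Longrightarrow> star A (star A x) = x"
    and star_add: "\<lbrakk>x \<in> carrier A; y \<in> carrier A\<rbrakk> \<Longrightarrow> star A (x \<oplus> y) = star A x \<oplus> star A y"
    and star_smult: "x \<in> carrier A \<Longrightarrow> star A (c \<odot> x) = cnj c \<odot> star A x"
    and star_mult: "\<lbrakk>x \<in> carrier A; y \<in> carrier A\<rbrakk> \<Longrightarrow> star A (x \<otimes> y) = star A y \<otimes> star A x"
    and nrm_nonneg: "x \<in> carrier A \<Longrightarrow> 0 \<le> nrm A x"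
    and nrm_eq_zero: "x \<in> carrier A \<Longrightarrow> nrm A x = 0 \<longleftrightarrow> x = \<zero>"
    and nrm_smult: "x \<in> carrier A \<Longrightarrow> nrm A (c \<odot> x) = cmod c * nrm A x"
    and nrm_triangle: "\<lbrakk>x \<in> carrier A; y \<in> carrier A\<rbrakk> \<Longrightarrow> nrm A (x \<oplus> y) \<le> nrm A x + nrm A y"
    and nrm_mult: "\<lbrakk>x \<in> carrier A; y \<in> carrier A\<rbrakk> \<Longrightarrow> nrm A (x \<otimes> y) \<le> nrm A x * nrm A y"
    and cstar_identity: "x \<in> carrier A \<Longrightarrow> nrm A (star A x \<otimes> x) = (nrm A x)\<^sup>2"
    and complete: "\<lbrakk>\<And>n::nat. X n \<in> carrier A;
            \<forall>e>0. \<exists>N. \<forall>m\<ge>N. \<forall>n\<ge>N. nrm A (X m \<ominus> X n) < e\<rbrakk>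
          \<Longrightarrow> \<exists>x\<in>carrier A. (\<lambda>n. nrm A (X n \<ominus> x)) \<longlonglongrightarrow> 0"

definition matrix_alg :: "(complex^'n^'n) cstar" where
  "matrix_alg = \<lparr>carrier = UNIV, monoid.mult = (**), one = mat 1, ring.zero = 0, add = (+),
     smult = (\<lambda>c a. \<chi> i j. c * a $ i $ j),
     star = (\<lambda>a. \<chi> i j. cnj (a $ j $ i)),
     nrm = (\<lambda>a. onorm (\<lambda>v. a *v v))\<rparr>"

definition linf_alg :: "(complex^'n) cstar" where
  "linf_alg = \<lparr>carrier = UNIV, monoid.mult = (*), one = 1, ring.zero = 0, add = (+),
     smult = (*s),
     star = (\<lambda>a. \<chi> i. cnj (a $ i)),
     nrm = (\<lambda>a. Max (range (\<lambda>i. cmod (a $ i))))\<rparr>"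

text \<open>A state is a positive linear functional of norm 1.\<close>

definition is_state :: "'a cstar \<Rightarrow> ('a \<Rightarrow> complex) \<Rightarrow> bool" where
  "is_state A f \<longleftrightarrow>
     (\<forall>x\<in>carrier A. \<forall>y\<in>carrier A. f (x \<oplus>\<^bsub>A\<^esub> y) = f x + f y) \<and>
     (\<forall>c. \<forall>x\<in>carrier A. f (c \<odot>\<^bsub>A\<^esub> x) = c * f x) \<and>
     (\<forall>x\<in>carrier A. f (star A x \<otimes>\<^bsub>A\<^esub> x) \<in> \<real> \<and> 0 \<le> Re (f (star A x \<otimes>\<^bsub>A\<^esub> x))) \<and>
     (SUP x\<in>{x \<in> carrier A. nrm A x \<le> 1}. ereal (cmod (f x))) = 1"

section \<open>The operator space structure of a C*-algebra\<close>

text \<open>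
  The *-algebra of \<open>n \<times> n\<close> matrices over \<open>A\<close>, equipped with a given norm \<open>\<nu>\<close>. Matrices are
  indexed by \<open>{..<n} \<times> {..<n}\<close> and are zero outside of this range.
\<close>

definition mat_alg :: "'a cstar \<Rightarrow> nat \<Rightarrow> ((nat \<Rightarrow> nat \<Rightarrow> 'a) \<Rightarrow> real) \<Rightarrow> (nat \<Rightarrow> nat \<Rightarrow> 'a) cstar" where
  "mat_alg A n \<nu> =
    \<lparr>carrier = {x. (\<forall>i<n. \<forall>j<n. x i j \<in> carrier A) \<and>
                   (\<forall>i j. \<not> (i < n \<and> j < n) \<longrightarrow> x i j = \<zero>\<^bsub>A\<^esub>)},
     monoid.mult = (\<lambda>x y i j. if i < n \<and> j < n
                              then (\<Oplus>\<^bsub>A\<^esub>k\<in>{..<n}. x i k \<otimes>\<^bsub>A\<^esub> y k j) else \<zero>\<^bsub>A\<^esub>),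
     one = (\<lambda>i j. if i < n \<and> i = j then \<one>\<^bsub>A\<^esub> else \<zero>\<^bsub>A\<^esub>),
     ring.zero = (\<lambda>i j. \<zero>\<^bsub>A\<^esub>),
     add = (\<lambda>x y i j. x i j \<oplus>\<^bsub>A\<^esub> y i j),
     smult = (\<lambda>c x i j. c \<odot>\<^bsub>A\<^esub> x i j),
     star = (\<lambda>x i j. if i < n \<and> j < n then star A (x j i) else \<zero>\<^bsub>A\<^esub>),
     nrm = \<nu>\<rparr>"

definition mat_carrier :: "'a cstar \<Rightarrow> nat \<Rightarrow> (nat \<Rightarrow> nat \<Rightarrow> 'a) set" where
  "mat_carrier A n = carrier (mat_alg A n (\<lambda>_. 0))"

text \<open>
  \<open>M\<^sub>n(A)\<close> carries its unique C*-norm. The definite description selects the value of that norm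
  at \<open>x\<close>, since a norm is determined on the carrier only.
\<close>

definition mat_norm :: "'a cstar \<Rightarrow> nat \<Rightarrow> (nat \<Rightarrow> nat \<Rightarrow> 'a) \<Rightarrow> real" where
  "mat_norm A n x = (THE r. \<exists>\<nu>. cstar_algebra (mat_alg A n \<nu>) \<and> \<nu> x = r)"

section \<open>The operator Hilbert space \<open>OH(I)\<close>\<close>

definition ell2 :: "'i set \<Rightarrow> ('i \<Rightarrow> complex) set" where
  "ell2 I = {v. (\<forall>i. i \<notin> I \<longrightarrow> v i = 0) \<and> (\<lambda>i. (cmod (v i))\<^sup>2) summable_on I}"

definition ell2_norm :: "'i set \<Rightarrow> ('i \<Rightarrow> complex) \<Rightarrow> real" where
  "ell2_norm I v = sqrt (\<Sum>\<^sub>\<infinity>i\<in>I. (cmod (v i))\<^sup>2)"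

text \<open>Operator norm on \<open>l\<^sup>2(J)\<close> of a matrix with index set \<open>J\<close>, for finite \<open>J\<close>.\<close>

definition kernel_opnorm :: "'j set \<Rightarrow> ('j \<Rightarrow> 'j \<Rightarrow> complex) \<Rightarrow> real" where
  "kernel_opnorm J K =
     (SUP v\<in>{v. L2_set (\<lambda>k. cmod (v k)) J \<le> 1}. L2_set (\<lambda>j. cmod (\<Sum>k\<in>J. K j k * v k)) J)"

text \<open>
  An element of \<open>M\<^sub>n(OH(I))\<close> is given by its entries \<open>y k l \<in> l\<^sup>2(I)\<close>, so \<open>y = \<Sum>\<^sub>i e\<^sub>i \<otimes> x\<^sub>i\<close>
  with \<open>x\<^sub>i = (y k l i)\<^sub>k\<^sub>l \<in> M\<^sub>n(\<complex>)\<close>. Identifying the conjugate algebra of \<open>M\<^sub>n(\<complex>)\<close> with \<open>M\<^sub>n(\<complex>)\<close>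
  by entrywise conjugation, the tensor product becomes the matrices over the index set
  \<open>{..<n} \<times> {..<n}\<close>, and the element \<open>x \<otimes> x-bar\<close> has the entry \<open>x k l * cnj (x k' l')\<close>
  in row \<open>(k, k')\<close> and column \<open>(l, l')\<close>. For families with infinite support the entries of
  \<open>\<Sum>\<^sub>i x\<^sub>i \<otimes> x\<^sub>i-bar\<close> are absolutely convergent sums, and the formula is the continuous
  extension of the finitely supported case.
\<close>

definition OH_norm :: "'i set \<Rightarrow> nat \<Rightarrow> (nat \<Rightarrow> nat \<Rightarrow> 'i \<Rightarrow> complex) \<Rightarrow> real" where
  "OH_norm I n y = sqrt (kernel_opnorm ({..<n} \<times> {..<n})
     (\<lambda>(k, k') (l, l'). \<Sum>\<^sub>\<infinity>i\<in>I. y k l i * cnj (y k' l' i)))"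

section \<open>Linear maps into \<open>OH(I)\<close>\<close>

definition linear_to_OH :: "'a cstar \<Rightarrow> 'i set \<Rightarrow> ('a \<Rightarrow> 'i \<Rightarrow> complex) \<Rightarrow> bool" where
  "linear_to_OH A I T \<longleftrightarrow>
     (\<forall>x\<in>carrier A. T x \<in> ell2 I) \<and>
     (\<forall>x\<in>carrier A. \<forall>y\<in>carrier A. T (x \<oplus>\<^bsub>A\<^esub> y) = (\<lambda>i. T x i + T y i)) \<and>
     (\<forall>c. \<forall>x\<in>carrier A. T (c \<odot>\<^bsub>A\<^esub> x) = (\<lambda>i. c * T x i))"

definition cb_norm :: "'a cstar \<Rightarrow> 'i set \<Rightarrow> ('a \<Rightarrow> 'i \<Rightarrow> complex) \<Rightarrow> ereal" where
  "cb_norm A I T =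
     (SUP n\<in>{1..}. SUP x\<in>{x \<in> mat_carrier A n. mat_norm A n x \<le> 1}.
        ereal (OH_norm I n (\<lambda>k l. T (x k l))))"

definition cb_to_OH :: "'a cstar \<Rightarrow> 'i set \<Rightarrow> ('a \<Rightarrow> 'i \<Rightarrow> complex) \<Rightarrow> bool" where
  "cb_to_OH A I T \<longleftrightarrow> linear_to_OH A I T \<and> cb_norm A I T < \<infinity>"

text \<open>The constant \<open>C(T)\<close>, with value \<open>\<infinity>\<close> if no constant is admissible.\<close>

definition C_const :: "'a cstar \<Rightarrow> 'i set \<Rightarrow> ('a \<Rightarrow> 'i \<Rightarrow> complex) \<Rightarrow> ereal" where
  "C_const A I T = Inf {ereal C | C. C > 0 \<and>
     (\<exists>f1 f2. is_state A f1 \<and> is_state A f2 \<and>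
       (\<forall>x\<in>carrier A. ell2_norm I (T x) \<le>
          C * Re (f1 (x \<otimes>\<^bsub>A\<^esub> star A x)) powr (1/4) * Re (f2 (star A x \<otimes>\<^bsub>A\<^esub> x)) powr (1/4)))}"

text \<open>
  The best constant in the noncommutative little Grothendieck inequality, where C*-algebras range
  over those with carrier in the type \<open>'u\<close> and index sets over the subsets of the type \<open>'i\<close>.
  The zero algebra is excluded since it has no states. Enlarging the types can only increase
  this constant, so a lower bound that holds for all sufficiently large types is also a lower
  bound for the constant over all C*-algebras and all index sets. (A type \<open>'u\<close> with continuum
  many elements accommodates \<open>M\<^sub>k(\<complex>)\<close>; a type that is too small has no nonzero C*-algebra.)
\<close>

definition best_constant :: "'u itself \<Rightarrow> 'i itself \<Rightarrow> ereal" where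
  "best_constant _ _ = Inf {ereal C | C. C \<ge> 0 \<and>
     (\<forall>(A :: 'u cstar) (I :: 'i set) T.
        cstar_algebra A \<and> carrier A \<noteq> {\<zero>\<^bsub>A\<^esub>} \<and> cb_to_OH A I T
        \<longrightarrow> C_const A I T \<le> ereal C * cb_norm A I T)}"

end

theory Submission
  imports Defs
begin

text \<open>
  Let \<open>A \<subseteq> M\<^sub>N(\<complex>)\<close> and let \<open>T\<close> have the coordinates \<open>x \<mapsto> Tr(a\<^sub>i\<^sup>* x)\<close>, where the \<open>a\<^sub>i \<in> A\<close> are orthogonal
  with \<open>Tr(a\<^sub>i\<^sup>* a\<^sub>i) = \<lambda>\<close> and both \<open>\<Sum> a\<^sub>i a\<^sub>i\<^sup>*\<close> and \<open>\<Sum> a\<^sub>i\<^sup>* a\<^sub>i\<close> are scalar. Testing on the \<open>a\<^sub>i\<close> gives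
  \<open>C(T)\<^sup>2 \<ge> \<lambda>N\<close>. For a contraction \<open>X = (X\<^sub>j\<^sub>k)\<close> in \<open>A \<otimes> M\<^sub>n\<close> put \<open>Y\<^sub>i = (Tr(a\<^sub>i\<^sup>* \<cdot>) \<otimes> id)(X)\<close>; the square of
  the cb-norm is the supremum of the Hilbert-Schmidt norms of the maps \<open>\<xi> \<mapsto> \<Sum> Y\<^sub>i \<xi> Y\<^sub>i\<^sup>*\<close>, and
  \<open>\<langle>\<Sum> Y\<^sub>i \<xi> Y\<^sub>i\<^sup>*, \<eta>\<rangle> = \<Sum> \<langle>Y\<^sub>i \<xi>, \<eta> Y\<^sub>i\<rangle> \<le> \<lambda>N\<close> for unit vectors. If the supremum were \<open>\<lambda>N\<close>, then along a
  sequence of self-adjoint \<open>\<xi>, \<eta>\<close>, with \<open>w\<^sub>i = Y\<^sub>i / \<lambda>\<close>, asymptotically \<open>w\<^sub>i \<xi> = \<eta> w\<^sub>i\<close>,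
  \<open>X \<xi> = (\<Sum> a\<^sub>i \<otimes> w\<^sub>i) \<xi>\<close> and \<open>X\<^sup>* X \<xi> = \<xi>\<close>, hence \<open>\<Sum> a\<^sub>i\<^sup>* a\<^sub>j \<otimes> w\<^sub>i\<^sup>* w\<^sub>j \<xi> = 1 \<otimes> \<xi>\<close>. Linear independence of
  the \<open>a\<^sub>i\<^sup>* a\<^sub>j\<close> determines \<open>w\<^sub>i\<^sup>* w\<^sub>j \<xi>\<close>: it is \<open>0\<close> for \<open>(i, j) = (p, q)\<close> and a nonzero multiple of \<open>\<xi>\<close> for
  \<open>(q, q)\<close>, while \<open>w\<^sub>p w\<^sub>p\<^sup>* \<eta>\<close> is a nonzero multiple of \<open>\<eta>\<close>. Then
  \<open>0 = w\<^sub>p w\<^sub>p\<^sup>* w\<^sub>q \<xi> = w\<^sub>p w\<^sub>p\<^sup>* \<eta> w\<^sub>q\<close> forces \<open>\<eta> w\<^sub>q = w\<^sub>q \<xi> = 0\<close>, which is impossible.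
\<close>

section \<open>Finitely supported matrices with the Hilbert-Schmidt inner product\<close>

text \<open>Matrices of every size n share this one type, because the sequences studied below have
  no common bound on n. It contains no unit.\<close>

typedef fmat = "{f :: nat \<Rightarrow> nat \<Rightarrow> complex. \<exists>n. \<forall>i j. n \<le> i \<or> n \<le> j \<longrightarrow> f i j = 0}"
  morphisms ent Fmat
  by (rule exI[of _ "\<lambda>_ _. 0"]) auto

setup_lifting type_definition_fmat

definition supp :: "nat \<Rightarrow> fmat \<Rightarrow> bool" where
  "supp n a \<longleftrightarrow> (\<forall>i j. n \<le> i \<or> n \<le> j \<longrightarrow> ent a i j = 0)"

lemma supp_mono: "supp m a \<Longrightarrow> m \<le> n \<Longrightarrow> supp n a"
  by (auto simp: supp_def)

lemma ex_supp: "\<exists>n. supp n a"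
  using ent[of a] by (auto simp: supp_def)

lemma supp2: obtains n where "supp n a" "supp n b"
  by (metis ex_supp supp_mono nle_le)

lemma supp3: obtains n where "supp n a" "supp n b" "supp n c"
  by (metis ex_supp supp_mono nle_le)

lemma fmat_eqI: "(\<And>i j. ent a i j = ent b i j) \<Longrightarrow> a = b"
  by (metis ent_inject ext)

lemma supp_eqI:
  assumes "supp n a" "supp n b" "\<And>i j. i < n \<Longrightarrow> j < n \<Longrightarrow> ent a i j = ent b i j"
  shows "a = b"
  using assms by (intro fmat_eqI) (metis supp_def not_less)

lemma ent_Fmat: "(\<And>i j. n \<le> i \<or> n \<le> j \<Longrightarrow> f i j = 0) \<Longrightarrow> ent (Fmat f) = f"
  by (intro Fmat_inverse) auto

instantiation fmat :: ab_group_add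
begin
lift_definition zero_fmat :: fmat is "\<lambda>_ _. 0" by auto
lift_definition plus_fmat :: "fmat \<Rightarrow> fmat \<Rightarrow> fmat" is "\<lambda>a b i j. a i j + b i j"
proof -
  fix f g :: "nat \<Rightarrow> nat \<Rightarrow> complex"
  assume "\<exists>n. \<forall>i j. n \<le> i \<or> n \<le> j \<longrightarrow> f i j = 0" "\<exists>n. \<forall>i j. n \<le> i \<or> n \<le> j \<longrightarrow> g i j = 0"
  then obtain m n where "\<forall>i j. m \<le> i \<or> m \<le> j \<longrightarrow> f i j = 0" "\<forall>i j. n \<le> i \<or> n \<le> j \<longrightarrow> g i j = 0" by blast
  then show "\<exists>n. \<forall>i j. n \<le> i \<or> n \<le> j \<longrightarrow> f i j + g i j = 0"
    by (intro exI[of _ "max m n"]) auto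
qed
lift_definition uminus_fmat :: "fmat \<Rightarrow> fmat" is "\<lambda>a i j. - a i j" by auto
definition minus_fmat :: "fmat \<Rightarrow> fmat \<Rightarrow> fmat" where "minus_fmat a b = a + - b"
instance by standard (auto simp: minus_fmat_def, (transfer, auto simp: algebra_simps)+)
end

lemma ent_0 [simp]: "ent 0 i j = 0" by transfer simp
lemma ent_add [simp]: "ent (a + b) i j = ent a i j + ent b i j" by transfer simp
lemma ent_minus [simp]: "ent (- a) i j = - ent a i j" by transfer simp
lemma ent_diff [simp]: "ent (a - b) i j = ent a i j - ent b i j"
  unfolding minus_fmat_def ent_add ent_minus by simp
lemma ent_sum [simp]: "ent (sum f A) i j = (\<Sum>x\<in>A. ent (f x) i j)"
  by (induction A rule: infinite_finite_induct) auto

lift_definition cs :: "complex \<Rightarrow> fmat \<Rightarrow> fmat" is "\<lambda>c a i j. c * a i j" by auto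

lift_definition adj :: "fmat \<Rightarrow> fmat" is "\<lambda>a i j. cnj (a j i)" by auto

lemma ent_cs [simp]: "ent (cs c a) i j = c * ent a i j" by transfer simp
lemma ent_adj [simp]: "ent (adj a) i j = cnj (ent a j i)" by transfer simp

instantiation fmat :: real_algebra
begin
definition scaleR_fmat :: "real \<Rightarrow> fmat \<Rightarrow> fmat" where "scaleR_fmat r = cs (of_real r)"
text \<open>The sum runs over the nonzero entries of row i, a finite set, so that no size has to be
  chosen.\<close>

lift_definition times_fmat :: "fmat \<Rightarrow> fmat \<Rightarrow> fmat" is
  "\<lambda>a b i j. \<Sum>k | a i k \<noteq> 0. a i k * b k j"
proof -
  fix f g :: "nat \<Rightarrow> nat \<Rightarrow> complex"
  assume "\<exists>n. \<forall>i j. n \<le> i \<or> n \<le> j \<longrightarrow> f i j = 0" "\<exists>n. \<forall>i j. n \<le> i \<or> n \<le> j \<longrightarrow> g i j = 0"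
  then obtain m n where "\<forall>i j. m \<le> i \<or> m \<le> j \<longrightarrow> f i j = 0" "\<forall>i j. n \<le> i \<or> n \<le> j \<longrightarrow> g i j = 0" by blast
  then show "\<exists>n. \<forall>i j. n \<le> i \<or> n \<le> j \<longrightarrow> (\<Sum>k | f i k \<noteq> 0. f i k * g k j) = 0"
    by (intro exI[of _ "max m n"]) (auto intro!: sum.neutral)
qed

lemma ent_mult: "supp n a \<Longrightarrow> ent (a * b) i j = (\<Sum>k<n. ent a i k * ent b k j)"
  unfolding supp_def
  by transfer (rule sum.mono_neutral_left, auto simp: not_less[symmetric])

instance
proof
  fix a b c :: fmat and r s :: real
  obtain n where n: "supp n a" "supp n b" "supp n c" by (rule supp3)
  have ab: "supp n (a * b)" "supp n (a + b)"
    using n by (auto simp: supp_def ent_mult[OF n(1)])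
  show "a * b * c = a * (b * c)"
    by (rule fmat_eqI, simp add: ent_mult[OF n(1)] ent_mult[OF n(2)] ent_mult[OF ab(1)] sum_distrib_left
        sum_distrib_right mult.assoc, rule sum.swap)
  show "(a + b) * c = a * c + b * c"
    by (rule fmat_eqI) (simp add: ent_mult[OF n(1)] ent_mult[OF n(2)] ent_mult[OF ab(2)] distrib_right sum.distrib)
  show "a * (b + c) = a * b + a * c"
    by (rule fmat_eqI) (simp add: ent_mult[OF n(1)] distrib_left sum.distrib)
  have r: "supp n (r *\<^sub>R a)" using n(1) by (simp add: supp_def scaleR_fmat_def)
  show "r *\<^sub>R a * b = r *\<^sub>R (a * b)"
    unfolding scaleR_fmat_def
    by (rule fmat_eqI) (simp add: ent_mult[OF n(1)] ent_mult[OF r[unfolded scaleR_fmat_def]] sum_distrib_left mult.assoc)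
  show "a * r *\<^sub>R b = r *\<^sub>R (a * b)"
    unfolding scaleR_fmat_def
    by (rule fmat_eqI) (simp add: ent_mult[OF n(1)] sum_distrib_left mult.left_commute)
qed (auto intro!: fmat_eqI simp: scaleR_fmat_def algebra_simps)
end

lemma supp_simps [intro]:
  "supp n 0" "supp n a \<Longrightarrow> supp n b \<Longrightarrow> supp n (a + b)" "supp n a \<Longrightarrow> supp n b \<Longrightarrow> supp n (a - b)"
  "supp n a \<Longrightarrow> supp n (- a)" "supp n a \<Longrightarrow> supp n (cs c a)" "supp n a \<Longrightarrow> supp n (adj a)"
  "(\<And>x. x \<in> A \<Longrightarrow> supp n (f x)) \<Longrightarrow> supp n (sum f A)"
  by (auto simp: supp_def)

lemma supp_mult [intro]: "supp n a \<Longrightarrow> supp n b \<Longrightarrow> supp n (a * b)"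
  by (auto simp: supp_def ent_mult[of n])

text \<open>This is Tr(b^* a), with the sum restricted to the finite support of
  \<open>a\<close>.\<close>

definition tr_inner :: "fmat \<Rightarrow> fmat \<Rightarrow> complex" where
  "tr_inner a b = (\<Sum>(i, j) | ent a i j \<noteq> 0. ent a i j * cnj (ent b i j))"

lemma tr_inner_eq:
  assumes "supp n a"
  shows "tr_inner a b = (\<Sum>i<n. \<Sum>j<n. ent a i j * cnj (ent b i j))"
  unfolding tr_inner_def sum.cartesian_product using assms
  by (intro sum.mono_neutral_left) (auto simp: supp_def not_less[symmetric])

section \<open>The Hilbert-Schmidt norm\<close>

instantiation fmat :: real_normed_algebra
begin
definition norm_fmat :: "fmat \<Rightarrow> real" where "norm_fmat a = sqrt (Re (tr_inner a a))"
definition dist_fmat :: "fmat \<Rightarrow> fmat \<Rightarrow> real" where "dist_fmat a b = norm (a - b)"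
definition sgn_fmat :: "fmat \<Rightarrow> fmat" where "sgn_fmat a = a /\<^sub>R norm a"
definition uniformity_fmat :: "(fmat \<times> fmat) filter" where
  "uniformity_fmat = (INF e\<in>{0<..}. principal {(x, y). dist x y < e})"
definition open_fmat :: "fmat set \<Rightarrow> bool" where
  "open_fmat U = (\<forall>x\<in>U. \<forall>\<^sub>F (x', y) in uniformity. x' = x \<longrightarrow> y \<in> U)"

lemma norm_fmat_L2:
  assumes "supp n a"
  shows "norm a = L2_set (\<lambda>(i, j). cmod (ent a i j)) ({..<n} \<times> {..<n})"
  by (simp add: norm_fmat_def tr_inner_eq[OF assms] L2_set_def sum.cartesian_product
      complex_mult_cnj cmod_power2 case_prod_unfold)

instance
proof
  fix a b :: fmat and r :: real
  obtain n where n: "supp n a" "supp n b" by (rule supp2)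
  note N = norm_fmat_L2[OF n(1)] norm_fmat_L2[OF n(2)]
  show "(norm a = 0) = (a = 0)"
    unfolding N using n supp_eqI[of n a 0] by (auto simp: L2_set_eq_0_iff)
  have "norm (a + b) \<le> L2_set (\<lambda>p. (case p of (i, j) \<Rightarrow> cmod (ent a i j)) + (case p of (i, j) \<Rightarrow> cmod (ent b i j))) ({..<n} \<times> {..<n})"
    unfolding norm_fmat_L2[OF supp_simps(2)[OF n]]
    by (intro L2_set_mono) (auto intro: norm_triangle_ineq)
  also have "\<dots> \<le> norm a + norm b" unfolding N by (rule L2_set_triangle_ineq)
  finally show "norm (a + b) \<le> norm a + norm b" .
  have "supp n (r *\<^sub>R a)" using n(1) by (simp add: supp_def scaleR_fmat_def)
  then show "norm (r *\<^sub>R a) = \<bar>r\<bar> * norm a"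
    unfolding N by (subst L2_set_right_distrib) (auto simp: norm_fmat_L2 scaleR_fmat_def norm_mult case_prod_unfold)
  show "norm (a * b) \<le> norm a * norm b"
  proof (rule power2_le_imp_le)
    have ab: "supp n (a * b)" using n by auto
    have sq: "(norm c)\<^sup>2 = (\<Sum>i<n. \<Sum>j<n. (cmod (ent c i j))\<^sup>2)" if "supp n c" for c
      by (simp add: norm_fmat_L2[OF that] L2_set_def sum_nonneg sum.cartesian_product case_prod_unfold)
    \<comment> \<open>Cauchy-Schwarz, applied below to each entry of the product: |(ab)_ij|^2 is at
      most the squared length of row i of \<open>a\<close> times that of column j of
      \<open>b\<close>.\<close>
    have cs: "(cmod (\<Sum>k<n. f k * g k))\<^sup>2 \<le> (\<Sum>k<n. (cmod (f k))\<^sup>2) * (\<Sum>k<n. (cmod (g k))\<^sup>2)" for f g :: "nat \<Rightarrow> complex"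
    proof -
      have "cmod (\<Sum>k<n. f k * g k) \<le> (\<Sum>k<n. \<bar>cmod (f k)\<bar> * \<bar>cmod (g k)\<bar>)"
        by (rule order.trans[OF norm_sum]) (simp add: norm_mult)
      also have "\<dots> \<le> L2_set (\<lambda>k. cmod (f k)) {..<n} * L2_set (\<lambda>k. cmod (g k)) {..<n}"
        by (rule L2_set_mult_ineq)
      finally have "(cmod (\<Sum>k<n. f k * g k))\<^sup>2 \<le> (L2_set (\<lambda>k. cmod (f k)) {..<n} * L2_set (\<lambda>k. cmod (g k)) {..<n})\<^sup>2"
        by (intro power_mono) auto
      then show ?thesis by (simp add: power_mult_distrib L2_set_def sum_nonneg)
    qed
    have "(norm (a * b))\<^sup>2 \<le> (\<Sum>i<n. \<Sum>j<n. (\<Sum>k<n. (cmod (ent a i k))\<^sup>2) * (\<Sum>k<n. (cmod (ent b k j))\<^sup>2))"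
      unfolding sq[OF ab] ent_mult[OF n(1)] by (intro sum_mono cs)
    also have "\<dots> = (\<Sum>i<n. \<Sum>k<n. (cmod (ent a i k))\<^sup>2) * (\<Sum>j<n. \<Sum>k<n. (cmod (ent b k j))\<^sup>2)"
      by (simp add: sum_product)
    also have "\<dots> = (norm a * norm b)\<^sup>2"
      unfolding power_mult_distrib sq[OF n(1)] sq[OF n(2)]
      by (rule arg_cong2[where f = "(*)", OF refl sum.swap])
    finally show "(norm (a * b))\<^sup>2 \<le> (norm a * norm b)\<^sup>2" .
    show "0 \<le> norm a * norm b" by (auto simp: N)
  qed
qed (rule dist_fmat_def sgn_fmat_def uniformity_fmat_def open_fmat_def)+
end

instantiation fmat :: real_inner
begin
text \<open>Only the real part is kept, which gives an instance of real inner product spaces;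
  complex scalars are carried by \<open>cs\<close>.\<close>

definition inner_fmat :: "fmat \<Rightarrow> fmat \<Rightarrow> real" where "inner_fmat a b = Re (tr_inner a b)"

lemma inner_fmat_eq:
  assumes "supp n a"
  shows "inner a b = (\<Sum>i<n. \<Sum>j<n. Re (ent a i j * cnj (ent b i j)))"
  by (simp add: inner_fmat_def tr_inner_eq[OF assms])

instance
proof
  fix a b c :: fmat and r :: real
  obtain n where n: "supp n a" "supp n b" "supp n c" by (rule supp3)
  show "inner a b = inner b a"
    unfolding inner_fmat_eq[OF n(1)] inner_fmat_eq[OF n(2)] by (simp add: algebra_simps)
  show "inner (a + b) c = inner a c + inner b c"
    unfolding inner_fmat_eq[OF n(1)] inner_fmat_eq[OF n(2)] inner_fmat_eq[OF supp_simps(2)[OF n(1,2)]]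
    by (simp add: algebra_simps sum.distrib sum_subtractf)
  have "supp n (r *\<^sub>R a)" using n(1) by (simp add: supp_def scaleR_fmat_def)
  then show "inner (r *\<^sub>R a) b = r * inner a b"
    by (simp add: inner_fmat_eq[of n] n(1) scaleR_fmat_def sum_distrib_left algebra_simps)
  show "norm a = sqrt (inner a a)" by (simp add: norm_fmat_def inner_fmat_def)
  show "0 \<le> inner a a" 
    unfolding inner_fmat_eq[OF n(1)] by (intro sum_nonneg) (simp add: complex_mult_cnj)
  then show "(inner a a = 0) = (a = 0)"
    by (metis \<open>norm a = sqrt (inner a a)\<close> norm_eq_zero real_sqrt_eq_zero_cancel_iff)
qed
end

lemma inner_fmat_commute_cs: "inner (cs c a) b = inner a (cs (cnj c) b)"
proof -
  obtain n where n: "supp n a" by (meson ex_supp)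
  then have "supp n (cs c a)" by auto
  with n show ?thesis by (simp add: inner_fmat_eq[of n] algebra_simps)
qed

section \<open>Calculus of adjoints and complex scalars\<close>

lemma adj_adj [simp]: "adj (adj a) = a" by (rule fmat_eqI) simp
lemma adj_add: "adj (a + b) = adj a + adj b" by (rule fmat_eqI) simp
lemma adj_diff: "adj (a - b) = adj a - adj b" by (rule fmat_eqI) simp
lemma adj_sum: "adj (sum f A) = (\<Sum>x\<in>A. adj (f x))" by (rule fmat_eqI) simp
lemma adj_cs: "adj (cs c a) = cs (cnj c) (adj a)" by (rule fmat_eqI) simp
lemma adj_mult: "adj (a * b) = adj b * adj a"
proof -
  obtain n where n: "supp n a" "supp n b" by (rule supp2)
  then have "supp n (adj b)" by auto
  then show ?thesis by (intro fmat_eqI) (simp add: ent_mult[OF n(1)] ent_mult[of n "adj b"] mult.commute)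
qed
lemma cs_add: "cs c (a + b) = cs c a + cs c b" by (rule fmat_eqI) (simp add: algebra_simps)
lemma cs_diff: "cs c (a - b) = cs c a - cs c b" by (rule fmat_eqI) (simp add: algebra_simps)
lemma cs_sum: "cs c (sum f A) = (\<Sum>x\<in>A. cs c (f x))" by (rule fmat_eqI) (simp add: sum_distrib_left)
lemma cs_cs [simp]: "cs c (cs d a) = cs (c * d) a" by (rule fmat_eqI) simp
lemma cs_0 [simp]: "cs c 0 = 0" "cs 0 a = 0" by (rule fmat_eqI, simp)+
lemma cs_1 [simp]: "cs 1 a = a" by (rule fmat_eqI) simp
lemma cs_minus: "cs (- c) a = - cs c a" by (rule fmat_eqI) simp
lemma cs_sum_left: "cs (sum f A) a = (\<Sum>x\<in>A. cs (f x) a)" by (rule fmat_eqI) (simp add: sum_distrib_right)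
lemma cs_mult_left: "cs c a * b = cs c (a * b)"
proof -
  obtain n where n: "supp n a" by (meson ex_supp)
  then have "supp n (cs c a)" by auto
  with n show ?thesis by (intro fmat_eqI) (simp add: ent_mult[of n] sum_distrib_left mult.assoc)
qed
lemma cs_mult_right: "a * cs c b = cs c (a * b)"
proof -
  obtain n where n: "supp n a" by (meson ex_supp)
  with n show ?thesis by (intro fmat_eqI) (simp add: ent_mult[of n] sum_distrib_left ac_simps)
qed
lemma norm_cs: "norm (cs c a) = cmod c * norm a"
proof -
  obtain n where n: "supp n a" by (meson ex_supp)
  then have "supp n (cs c a)" by auto
  with n show ?thesis
    by (simp add: norm_fmat_L2[of n] norm_mult case_prod_unfold L2_set_right_distrib)
qed

lemma inner_adj_adj: "inner (adj a) (adj b) = inner a b"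
proof -
  obtain n where n: "supp n a" by (meson ex_supp)
  then have "supp n (adj a)" by auto
  with n show ?thesis
    by (simp add: inner_fmat_eq[of n]) (subst sum.swap, simp)
qed

lemma norm_adj [simp]: "norm (adj a) = norm a"
  by (simp add: norm_eq_sqrt_inner inner_adj_adj)

lemma inner_mult_left: "inner (a * b) c = inner b (adj a * c)"
proof -
  obtain n where n: "supp n a" "supp n b" "supp n c" by (rule supp3)
  then have s: "supp n (a * b)" "supp n (adj a)" by auto
  have "inner (a * b) c = (\<Sum>i<n. \<Sum>j<n. \<Sum>k<n. Re (ent a i k * ent b k j * cnj (ent c i j)))"
    unfolding inner_fmat_eq[OF s(1)] ent_mult[OF n(1)] by (simp only: sum_distrib_right Re_sum)
  also have "\<dots> = (\<Sum>k<n. \<Sum>j<n. \<Sum>i<n. Re (ent a i k * ent b k j * cnj (ent c i j)))"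
  proof -
    have "(\<Sum>i<n. \<Sum>j<n. \<Sum>k<n. F i j k) = (\<Sum>k<n. \<Sum>j<n. \<Sum>i<n. F i j k)" for F :: "nat \<Rightarrow> nat \<Rightarrow> nat \<Rightarrow> real"
    proof -
      have "(\<Sum>i<n. \<Sum>j<n. \<Sum>k<n. F i j k) = (\<Sum>j<n. \<Sum>i<n. \<Sum>k<n. F i j k)" by (rule sum.swap)
      also have "\<dots> = (\<Sum>j<n. \<Sum>k<n. \<Sum>i<n. F i j k)" by (intro sum.cong refl sum.swap)
      also have "\<dots> = (\<Sum>k<n. \<Sum>j<n. \<Sum>i<n. F i j k)" by (rule sum.swap)
      finally show ?thesis .
    qed
    then show ?thesis .
  qed
  also have "\<dots> = inner b (adj a * c)"
    unfolding inner_fmat_eq[OF n(2)] ent_mult[OF s(2)] cnj_sum sum_distrib_left Re_sum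
    by (simp add: algebra_simps)
  finally show ?thesis .
qed

text \<open>Since \<open>adj\<close> preserves the inner product and reverses products, this is
  \<open>inner_mult_left\<close> after taking adjoints.\<close>

lemma inner_mult_right: "inner (a * b) c = inner a (c * adj b)"
proof -
  have "inner (a * b) c = inner (adj b * adj a) (adj c)"
    by (metis inner_adj_adj adj_mult)
  also have "\<dots> = inner (adj a) (b * adj c)" by (simp add: inner_mult_left)
  also have "\<dots> = inner a (c * adj b)" by (metis inner_adj_adj adj_mult adj_adj)
  finally show ?thesis .
qed

section \<open>Contractive block matrices and asymptotic equality\<close>

text \<open>The test vectors are tuples of matrices. Left multiplication acts on each matrix column
  separately, so this says that the block matrix X is an ordinary operator contraction, in a form
  where Hilbert-Schmidt matrices can be inserted directly.\<close>

definition contr :: "('j::finite \<Rightarrow> 'j \<Rightarrow> fmat) \<Rightarrow> bool" where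
  "contr X \<longleftrightarrow> (\<forall>h. (\<Sum>j\<in>UNIV. (norm (\<Sum>k\<in>UNIV. X j k * h k))\<^sup>2) \<le> (\<Sum>k\<in>UNIV. (norm (h k))\<^sup>2))"

lemma contrD:
  "contr X \<Longrightarrow> (\<Sum>j\<in>UNIV. (norm (\<Sum>k\<in>UNIV. X j k * h k))\<^sup>2) \<le> (\<Sum>k\<in>UNIV. (norm (h k))\<^sup>2)"
  by (simp add: contr_def)

text \<open>With z = X^* h one has |z|^2 = <h, X z> \<le> |h| |z|.\<close>

lemma contr_adj:
  assumes "contr X"
  shows "contr (\<lambda>j k. adj (X k j))"
  unfolding contr_def
proof
  fix h :: "'a \<Rightarrow> fmat"
  define z where "z j = (\<Sum>k\<in>UNIV. adj (X k j) * h k)" for j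
  define S where "S = (\<Sum>j\<in>UNIV. (norm (z j))\<^sup>2)"
  define H where "H = (\<Sum>j\<in>UNIV. (norm (h j))\<^sup>2)"
  have "S = (\<Sum>j\<in>UNIV. inner (z j) (z j))" by (simp add: S_def dot_square_norm)
  also have "\<dots> = (\<Sum>j\<in>UNIV. \<Sum>k\<in>UNIV. inner (h k) (X k j * z j))"
    by (rule sum.cong[OF refl], subst (1) z_def) (simp add: inner_sum_left inner_mult_left)
  also have "\<dots> = (\<Sum>k\<in>UNIV. inner (h k) (\<Sum>j\<in>UNIV. X k j * z j))"
    by (subst sum.swap) (simp add: inner_sum_right)
  also have "\<dots> \<le> (\<Sum>k\<in>UNIV. \<bar>norm (h k)\<bar> * \<bar>norm (\<Sum>j\<in>UNIV. X k j * z j)\<bar>)"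
    by (intro sum_mono) (simp add: norm_cauchy_schwarz)
  also have "\<dots> \<le> L2_set (\<lambda>k. norm (h k)) UNIV * L2_set (\<lambda>k. norm (\<Sum>j\<in>UNIV. X k j * z j)) UNIV"
    by (rule L2_set_mult_ineq)
  also have "\<dots> \<le> sqrt H * sqrt S"
    unfolding L2_set_def H_def S_def
    by (intro mult_mono real_sqrt_le_mono contrD[OF assms] real_sqrt_ge_zero sum_nonneg) auto
  finally have "S \<le> sqrt H * sqrt S" .
  moreover have "S \<ge> 0" "H \<ge> 0" by (auto simp: S_def H_def intro: sum_nonneg)
  ultimately have "S \<le> H"
    by (smt (verit) mult_le_cancel_right real_le_lsqrt real_sqrt_eq_zero_cancel_iff real_sqrt_ge_0_iff
        real_sqrt_le_iff real_sqrt_mult_self)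
  then show "(\<Sum>j\<in>UNIV. (norm (\<Sum>k\<in>UNIV. adj (X k j) * h k))\<^sup>2) \<le> (\<Sum>k\<in>UNIV. (norm (h k))\<^sup>2)"
    by (simp add: S_def H_def z_def)
qed

lemma contr_column:
  assumes "contr X"
  shows "(\<Sum>j\<in>UNIV. (norm (X j k * h))\<^sup>2) \<le> (norm h)\<^sup>2"
proof -
  have *: "X j l * (if l = k then h else 0) = (if l = k then X j k * h else 0)" for j l
    by simp
  have **: "(norm (if l = k then h else 0))\<^sup>2 = (if l = k then (norm h)\<^sup>2 else 0)" for l
    by simp
  show ?thesis
    using contrD[OF assms, of "\<lambda>l. if l = k then h else 0"] by (simp add: * ** cong: if_cong)
qed

lemma contr_entry:
  assumes "contr X"
  shows "norm (X j k * h) \<le> norm h"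
proof -
  have "(norm (X j k * h))\<^sup>2 \<le> (\<Sum>j\<in>UNIV. (norm (X j k * h))\<^sup>2)"
    by (rule member_le_sum) auto
  also have "\<dots> \<le> (norm h)\<^sup>2" by (rule contr_column[OF assms])
  finally show ?thesis by (rule power2_le_imp_le) simp
qed

lemma contr_entry_right:
  assumes "contr X"
  shows "norm (h * X j k) \<le> norm h"
  using contr_entry[OF contr_adj[OF assms], of j k "adj h"] norm_adj[of "h * X j k"]
  by (simp add: adj_mult del: norm_adj) simp

text \<open>Let v have \<open>\<xi>\<close> in position l and 0 elsewhere. Then |X^* X v - v|^2 =
  |X^* X v|^2 - 2 |X v|^2 + 1 \<le> 1 - |X v|^2, and this is summed over l. So X^* X almost fixes
  the vectors whose norm X almost preserves.\<close>

lemma contr_isometry_defect: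
  fixes X :: "'j::finite \<Rightarrow> 'j \<Rightarrow> fmat"
  assumes "contr X" and "norm \<xi> = 1"
  shows "(\<Sum>k\<in>UNIV. \<Sum>l\<in>UNIV. (norm ((\<Sum>j\<in>UNIV. adj (X j k) * X j l * \<xi>) - (if k = l then \<xi> else 0)))\<^sup>2)
    \<le> real CARD('j) - (\<Sum>j\<in>UNIV. \<Sum>l\<in>UNIV. (norm (X j l * \<xi>))\<^sup>2)"
proof -
  define z where "z k l = (\<Sum>j\<in>UNIV. adj (X j k) * (X j l * \<xi>))" for k l
  define G where "G = (\<Sum>l\<in>UNIV. \<Sum>j\<in>UNIV. (norm (X j l * \<xi>))\<^sup>2)"
  have sq: "(norm (z k l - (if k = l then \<xi> else 0)))\<^sup>2
    = (norm (z k l))\<^sup>2 - 2 * (if k = l then inner (z l l) \<xi> else 0) + (if k = l then 1 else 0)" for k l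
    using assms(2) by (simp add: power2_norm_eq_inner algebra_simps inner_commute norm_eq_1)
  have zz: "inner (z l l) \<xi> = (\<Sum>j\<in>UNIV. (norm (X j l * \<xi>))\<^sup>2)" for l
    by (simp add: z_def inner_sum_left inner_mult_left power2_norm_eq_inner)
  have z2: "(\<Sum>k\<in>UNIV. \<Sum>l\<in>UNIV. (norm (z k l))\<^sup>2) \<le> G"
    unfolding G_def z_def
    by (subst sum.swap) (intro sum_mono contrD[OF contr_adj[OF assms(1)]])
  have "(\<Sum>k\<in>UNIV. \<Sum>l\<in>UNIV. (norm (z k l - (if k = l then \<xi> else 0)))\<^sup>2)
     = (\<Sum>k\<in>UNIV. \<Sum>l\<in>UNIV. (norm (z k l))\<^sup>2) - 2 * G + real CARD('j)"
    unfolding sq by (simp add: sum.distrib sum_subtractf sum_distrib_left[symmetric] zz G_def)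
  also have "\<dots> \<le> real CARD('j) - G" using z2 by simp
  finally show ?thesis
    unfolding z_def G_def by (subst (2) sum.swap) (simp add: mult.assoc)
qed

text \<open>Pythagoras: the subtracted sum is the orthogonal projection of P onto the matrix-valued
  span of the \<open>a i\<close>, and its squared norm is \<Sum> |p_i|^2 / lam because the
  \<open>a i\<close> are orthogonal of squared length lam.\<close>

lemma bessel_defect:
  fixes a :: "'i \<Rightarrow> 'x::finite \<Rightarrow> complex" and P :: "'x \<Rightarrow> fmat"
  assumes "finite I" and "lam > 0"
    and orth: "\<And>i i'. i \<in> I \<Longrightarrow> i' \<in> I \<Longrightarrow> (\<Sum>x\<in>UNIV. cnj (a i x) * a i' x) = (if i = i' then of_real lam else 0)"
    and p: "\<And>i. p i = (\<Sum>x\<in>UNIV. cs (cnj (a i x)) (P x))"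
  shows "(\<Sum>x\<in>UNIV. (norm (P x - (\<Sum>i\<in>I. cs (a i x / of_real lam) (p i))))\<^sup>2)
    = (\<Sum>x\<in>UNIV. (norm (P x))\<^sup>2) - (\<Sum>i\<in>I. (norm (p i))\<^sup>2) / lam"
proof -
  define r where "r x = (\<Sum>i\<in>I. cs (a i x / of_real lam) (p i))" for x
  have cs_re: "inner (cs (of_real c) b) d = c * inner b d" "inner b (cs (of_real c) d) = c * inner b d" for c b d
    by (simp_all flip: scaleR_fmat_def)
  have 1: "(\<Sum>x\<in>UNIV. inner (P x) (r x)) = (\<Sum>i\<in>I. (norm (p i))\<^sup>2) / lam"
  proof -
    have "(\<Sum>x\<in>UNIV. inner (P x) (r x)) = (\<Sum>x\<in>UNIV. \<Sum>i\<in>I. inner (cs (cnj (a i x) / of_real lam) (P x)) (p i))"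
      by (simp add: r_def inner_sum_right inner_fmat_commute_cs)
    also have "\<dots> = (\<Sum>i\<in>I. inner (cs (of_real (1 / lam)) (p i)) (p i))"
      by (subst sum.swap) (simp add: p cs_sum inner_sum_left)
    also have "\<dots> = (\<Sum>i\<in>I. (norm (p i))\<^sup>2) / lam"
      unfolding cs_re by (simp add: sum_divide_distrib power2_norm_eq_inner)
    finally show ?thesis .
  qed
  have 2: "(\<Sum>x\<in>UNIV. inner (r x) (r x)) = (\<Sum>i\<in>I. (norm (p i))\<^sup>2) / lam"
  proof -
    have "(\<Sum>x\<in>UNIV. inner (r x) (r x))
      = (\<Sum>x\<in>UNIV. \<Sum>i\<in>I. \<Sum>i'\<in>I. inner (p i) (cs (cnj (a i x) * a i' x / of_real (lam\<^sup>2)) (p i')))"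
      by (simp add: r_def inner_sum_right inner_sum_left inner_fmat_commute_cs power2_eq_square) (subst sum.swap, simp)?
    also have "\<dots> = (\<Sum>i\<in>I. \<Sum>i'\<in>I. inner (p i) (cs ((\<Sum>x\<in>UNIV. cnj (a i x) * a i' x) / of_real (lam\<^sup>2)) (p i')))"
      by (subst sum.swap, rule sum.cong[OF refl], subst sum.swap)
         (simp add: cs_sum_left inner_sum_right sum_divide_distrib)
    also have "\<dots> = (\<Sum>i\<in>I. \<Sum>i'\<in>I. if i = i' then (norm (p i))\<^sup>2 / lam else 0)"
    proof (intro sum.cong refl)
      fix i i' assume i: "i \<in> I" "i' \<in> I"
      have "of_real lam / of_real (lam\<^sup>2) = complex_of_real (1 / lam)" using assms(2) by (simp add: power2_eq_square)
      then have "inner (p i) (cs (of_real lam / of_real (lam\<^sup>2)) (p i)) = (norm (p i))\<^sup>2 / lam"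
        by (simp only: cs_re power2_norm_eq_inner) simp
      then show "inner (p i) (cs ((\<Sum>x\<in>UNIV. cnj (a i x) * a i' x) / of_real (lam\<^sup>2)) (p i')) = (if i = i' then (norm (p i))\<^sup>2 / lam else 0)"
        unfolding orth[OF i] by (cases "i = i'") auto
    qed
    also have "\<dots> = (\<Sum>i\<in>I. (norm (p i))\<^sup>2) / lam" using assms(1) by (simp add: sum_divide_distrib)
    finally show ?thesis .
  qed
  have "(\<Sum>x\<in>UNIV. (norm (P x - r x))\<^sup>2) = (\<Sum>x\<in>UNIV. (norm (P x))\<^sup>2 - 2 * inner (P x) (r x) + inner (r x) (r x))"
    by (intro sum.cong refl) (simp add: power2_norm_eq_inner algebra_simps inner_commute)
  also have "\<dots> = (\<Sum>x\<in>UNIV. (norm (P x))\<^sup>2) - 2 * ((\<Sum>i\<in>I. (norm (p i))\<^sup>2) / lam) + (\<Sum>i\<in>I. (norm (p i))\<^sup>2) / lam"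
    by (simp add: sum.distrib sum_subtractf sum_distrib_left[symmetric] 1 2 del: times_divide_eq_right)
  finally show ?thesis by (simp add: r_def)
qed

section \<open>Uniformly bounded multipliers and equality up to null sequences\<close>

definition bop :: "(nat \<Rightarrow> fmat) \<Rightarrow> bool" where
  "bop X \<longleftrightarrow> (\<exists>K\<ge>0. \<forall>n h. norm (X n * h) \<le> K * norm h \<and> norm (h * X n) \<le> K * norm h)"

lemma bop_0: "bop (\<lambda>n. 0)" by (auto simp: bop_def)

lemma bop_add:
  assumes "bop X" "bop Y"
  shows "bop (\<lambda>n. X n + Y n)"
proof -
  obtain K L where "K \<ge> 0" "L \<ge> 0"
    and *: "\<And>n h. norm (X n * h) \<le> K * norm h" "\<And>n h. norm (h * X n) \<le> K * norm h"
      "\<And>n h. norm (Y n * h) \<le> L * norm h" "\<And>n h. norm (h * Y n) \<le> L * norm h"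
    using assms unfolding bop_def by metis
  then show ?thesis
    unfolding bop_def
    by (intro exI[of _ "K + L"]) (auto simp: distrib_left distrib_right intro!: norm_triangle_le add_mono)
qed

lemma bop_sum: "(\<And>x. x \<in> A \<Longrightarrow> bop (\<lambda>n. X n x)) \<Longrightarrow> bop (\<lambda>n. \<Sum>x\<in>A. X n x)"
  by (induction A rule: infinite_finite_induct) (auto intro: bop_0 bop_add)

lemma bop_cs:
  assumes "bop X"
  shows "bop (\<lambda>n. cs c (X n))"
proof -
  obtain K where "K \<ge> 0" "\<And>n h. norm (X n * h) \<le> K * norm h" "\<And>n h. norm (h * X n) \<le> K * norm h"
    using assms unfolding bop_def by metis
  then show ?thesis
    unfolding bop_def
    by (intro exI[of _ "cmod c * K"]) (auto simp: cs_mult_left cs_mult_right norm_cs mult.assoc intro!: mult_left_mono)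
qed

lemma bop_adj:
  assumes "bop X"
  shows "bop (\<lambda>n. adj (X n))"
proof -
  obtain K where K: "K \<ge> 0" "\<And>n h. norm (X n * h) \<le> K * norm h" "\<And>n h. norm (h * X n) \<le> K * norm h"
    using assms unfolding bop_def by metis
  have "norm (adj (X n) * h) \<le> K * norm h" "norm (h * adj (X n)) \<le> K * norm h" for n h
    using K(2)[of n "adj h"] K(3)[of "adj h" n] norm_adj[of "adj h * X n"] norm_adj[of "X n * adj h"]
    by (simp_all add: adj_mult del: norm_adj) (simp_all)
  with K(1) show ?thesis unfolding bop_def by blast
qed

lemma bop_contr: "(\<And>n. contr (X n)) \<Longrightarrow> bop (\<lambda>n. X n j k)"
  unfolding bop_def by (intro exI[of _ 1]) (auto simp: contr_entry contr_entry_right)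

text \<open>A supremum over all n need not be attained, so the identities of the extremal case are
  only available up to null sequences. A \<open>bop\<close> sequence may multiply such an identity
  from either side.\<close>

definition asym_eq :: "(nat \<Rightarrow> fmat) \<Rightarrow> (nat \<Rightarrow> fmat) \<Rightarrow> bool" (infix "\<approxeq>" 50) where
  "u \<approxeq> v \<longleftrightarrow> (\<lambda>n. norm (u n - v n)) \<longlonglongrightarrow> 0"

lemma asym_eqI_bound:
  assumes "f \<longlonglongrightarrow> 0" and "\<And>n. (norm (u n - v n))\<^sup>2 \<le> f n"
  shows "u \<approxeq> v"
proof -
  have "(\<lambda>n. (norm (u n - v n))\<^sup>2) \<longlonglongrightarrow> 0"
    by (rule tendsto_sandwich[OF _ _ tendsto_const assms(1)]) (use assms(2) in auto)
  then have "(\<lambda>n. sqrt ((norm (u n - v n))\<^sup>2)) \<longlonglongrightarrow> sqrt 0" by (rule tendsto_real_sqrt)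
  then show ?thesis by (simp add: asym_eq_def)
qed

lemma asym_eqI_linear:
  assumes "f \<longlonglongrightarrow> 0" and "\<And>n. norm (u n - v n) \<le> K * f n"
  shows "u \<approxeq> v"
  unfolding asym_eq_def
proof (rule tendsto_sandwich[OF _ _ tendsto_const])
  show "(\<lambda>n. K * f n) \<longlonglongrightarrow> 0" using tendsto_mult_right_zero[OF assms(1)] by simp
qed (use assms(2) in auto)

lemma asym_refl: "u \<approxeq> u" by (simp add: asym_eq_def)

lemma asym_sym: "u \<approxeq> v \<Longrightarrow> v \<approxeq> u" by (simp add: asym_eq_def norm_minus_commute)

lemma asym_add:
  assumes "u \<approxeq> v" "u' \<approxeq> v'"
  shows "(\<lambda>n. u n + u' n) \<approxeq> (\<lambda>n. v n + v' n)"
  unfolding asym_eq_def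
proof (rule tendsto_sandwich[OF _ _ tendsto_const])
  show "(\<lambda>n. norm (u n - v n) + norm (u' n - v' n)) \<longlonglongrightarrow> 0"
    using tendsto_add[OF assms[unfolded asym_eq_def]] by simp
  show "\<forall>\<^sub>F n in sequentially. norm (u n + u' n - (v n + v' n)) \<le> norm (u n - v n) + norm (u' n - v' n)"
    by (rule always_eventually) (metis add_diff_add norm_triangle_ineq)
qed auto

lemma asym_trans [trans]:
  assumes "u \<approxeq> v" "v \<approxeq> w"
  shows "u \<approxeq> w"
proof -
  have "(\<lambda>n. u n + v n - v n) \<approxeq> (\<lambda>n. v n + w n - v n)"
    using asym_add[OF assms] unfolding asym_eq_def by simp
  then show ?thesis by simp
qed

lemma asym_sum: "(\<And>x. x \<in> A \<Longrightarrow> (\<lambda>n. u n x) \<approxeq> (\<lambda>n. v n x)) \<Longrightarrow> (\<lambda>n. \<Sum>x\<in>A. u n x) \<approxeq> (\<lambda>n. \<Sum>x\<in>A. v n x)"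
  by (induction A rule: infinite_finite_induct) (auto intro: asym_refl asym_add)

lemma asym_cs:
  assumes "u \<approxeq> v"
  shows "(\<lambda>n. cs c (u n)) \<approxeq> (\<lambda>n. cs c (v n))"
  by (rule asym_eqI_linear[OF assms[unfolded asym_eq_def], of _ _ "cmod c"]) (simp add: cs_diff[symmetric] norm_cs)

lemma asym_adj: "u \<approxeq> v \<Longrightarrow> (\<lambda>n. adj (u n)) \<approxeq> (\<lambda>n. adj (v n))"
  by (simp add: asym_eq_def adj_diff[symmetric])

lemma asym_mult_left:
  assumes "bop X" "u \<approxeq> v"
  shows "(\<lambda>n. X n * u n) \<approxeq> (\<lambda>n. X n * v n)"
proof -
  obtain K where K: "\<And>n h. norm (X n * h) \<le> K * norm h"
    using assms unfolding bop_def by metis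
  show ?thesis
    by (rule asym_eqI_linear[OF assms(2)[unfolded asym_eq_def], of _ _ K]) (simp add: right_diff_distrib[symmetric] K)
qed

lemma asym_mult_right:
  assumes "bop X" "u \<approxeq> v"
  shows "(\<lambda>n. u n * X n) \<approxeq> (\<lambda>n. v n * X n)"
proof -
  obtain K where K: "\<And>n h. norm (h * X n) \<le> K * norm h"
    using assms unfolding bop_def by metis
  show ?thesis
    by (rule asym_eqI_linear[OF assms(2)[unfolded asym_eq_def], of _ _ K]) (simp add: left_diff_distrib[symmetric] K)
qed

section \<open>The spectral gap of rigid families\<close>

text \<open>
  \<open>b\<close> is a functional that reads off the coefficient of \<open>a\<^sub>r\<^sup>* a\<^sub>s\<close> in the span of the \<open>a\<^sub>i\<^sup>* a\<^sub>j\<close>, and \<open>c\<close> is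
  its value at the identity matrix.
\<close>

definition dual_coeff :: "'i set \<Rightarrow> ('i \<Rightarrow> 'j::finite \<Rightarrow> 'j \<Rightarrow> complex) \<Rightarrow> 'i \<Rightarrow> 'i \<Rightarrow> complex \<Rightarrow> bool" where
  "dual_coeff I a r s c \<longleftrightarrow> (\<exists>b. (\<Sum>k\<in>UNIV. b k k) = c \<and>
     (\<forall>i\<in>I. \<forall>i'\<in>I. (\<Sum>k\<in>UNIV. \<Sum>l\<in>UNIV. b k l * (\<Sum>j\<in>UNIV. cnj (a i j k) * a i' j l)) =
        (if i = r \<and> i' = s then 1 else 0)))"

text \<open>Expanded in the products W_i^* W_i' \<xi>, the blocks of u^* u \<xi> have the entries of
  a_i^* a_i' as coefficients. The functional b therefore extracts W_r^* W_s \<xi> from the left side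
  of \<open>iso\<close>, and it turns the right side into c \<xi>.\<close>

lemma dual_coeff_asym:
  fixes a :: "'i \<Rightarrow> 'j::finite \<Rightarrow> 'j \<Rightarrow> complex"
  assumes "finite I" "r \<in> I" "s \<in> I" "dual_coeff I a r s c"
    and u: "\<And>n j k. u n j k = (\<Sum>i\<in>I. cs (a i j k) (W n i))"
    and iso: "\<And>k l. (\<lambda>n. \<Sum>j\<in>UNIV. adj (u n j k) * u n j l * \<xi> n) \<approxeq> (\<lambda>n. if k = l then \<xi> n else 0)"
  shows "(\<lambda>n. adj (W n r) * W n s * \<xi> n) \<approxeq> (\<lambda>n. cs c (\<xi> n))"
proof -
  obtain b where c: "(\<Sum>k\<in>UNIV. b k k) = c"
    and b: "\<And>i i'. i \<in> I \<Longrightarrow> i' \<in> I \<Longrightarrow>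
      (\<Sum>k\<in>UNIV. \<Sum>l\<in>UNIV. b k l * (\<Sum>j\<in>UNIV. cnj (a i j k) * a i' j l)) = (if i = r \<and> i' = s then 1 else 0)"
    using assms(4) unfolding dual_coeff_def by auto
  have "(\<Sum>k\<in>UNIV. \<Sum>l\<in>UNIV. cs (b k l) (\<Sum>j\<in>UNIV. adj (u n j k) * u n j l * \<xi> n)) = adj (W n r) * W n s * \<xi> n" for n
  proof -
    define V where "V i i' = adj (W n i) * W n i' * \<xi> n" for i i'
    have "(\<Sum>j\<in>UNIV. adj (u n j k) * u n j l * \<xi> n) = (\<Sum>i\<in>I. \<Sum>i'\<in>I. cs (\<Sum>j\<in>UNIV. cnj (a i j k) * a i' j l) (V i i'))" for k l
    proof -
      have "(\<Sum>j\<in>UNIV. adj (u n j k) * u n j l * \<xi> n) = (\<Sum>j\<in>UNIV. \<Sum>i\<in>I. \<Sum>i'\<in>I. cs (cnj (a i j k) * a i' j l) (V i i'))"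
        unfolding u V_def adj_sum adj_cs sum_distrib_right sum_distrib_left cs_mult_left cs_mult_right cs_sum cs_cs
        by (rule sum.cong[OF refl], subst sum.swap) (simp add: mult.commute)
      also have "\<dots> = (\<Sum>i\<in>I. \<Sum>i'\<in>I. \<Sum>j\<in>UNIV. cs (cnj (a i j k) * a i' j l) (V i i'))"
        by (subst sum.swap, rule sum.cong[OF refl], rule sum.swap)
      finally show ?thesis by (simp add: cs_sum_left)
    qed
    then have "(\<Sum>k\<in>UNIV. \<Sum>l\<in>UNIV. cs (b k l) (\<Sum>j\<in>UNIV. adj (u n j k) * u n j l * \<xi> n))
      = (\<Sum>k\<in>UNIV. \<Sum>l\<in>UNIV. \<Sum>i\<in>I. \<Sum>i'\<in>I. cs (b k l * (\<Sum>j\<in>UNIV. cnj (a i j k) * a i' j l)) (V i i'))"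
      by (simp add: cs_sum)
    also have "\<dots> = (\<Sum>k\<in>UNIV. \<Sum>i\<in>I. \<Sum>i'\<in>I. \<Sum>l\<in>UNIV. cs (b k l * (\<Sum>j\<in>UNIV. cnj (a i j k) * a i' j l)) (V i i'))"
      by (rule sum.cong[OF refl], subst sum.swap, rule sum.cong[OF refl], rule sum.swap)
    also have "\<dots> = (\<Sum>i\<in>I. \<Sum>i'\<in>I. \<Sum>k\<in>UNIV. \<Sum>l\<in>UNIV. cs (b k l * (\<Sum>j\<in>UNIV. cnj (a i j k) * a i' j l)) (V i i'))"
      by (subst sum.swap, rule sum.cong[OF refl], rule sum.swap)
    also have "\<dots> = (\<Sum>i\<in>I. \<Sum>i'\<in>I. cs (\<Sum>k\<in>UNIV. \<Sum>l\<in>UNIV. b k l * (\<Sum>j\<in>UNIV. cnj (a i j k) * a i' j l)) (V i i'))"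
      unfolding cs_sum_left ..
    also have "\<dots> = (\<Sum>i\<in>I. \<Sum>i'\<in>I. if i' = s then (if i = r then V i i' else 0) else 0)"
      by (intro sum.cong refl) (simp add: b)
    also have "\<dots> = V r s" using assms(1-3) by simp
    finally show ?thesis by (simp add: V_def)
  qed
  moreover have "(\<Sum>k\<in>UNIV. \<Sum>l\<in>UNIV. cs (b k l) (if k = l then \<xi> n else 0)) = cs c (\<xi> n)" for n
  proof -
    have "cs (b k l) (if k = l then \<xi> n else 0) = (if k = l then cs (b k k) (\<xi> n) else 0)" for k l by simp
    then show ?thesis by (simp add: cs_sum_left c[symmetric])
  qed
  moreover have "(\<lambda>n. \<Sum>k\<in>UNIV. \<Sum>l\<in>UNIV. cs (b k l) (\<Sum>j\<in>UNIV. adj (u n j k) * u n j l * \<xi> n))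
    \<approxeq> (\<lambda>n. \<Sum>k\<in>UNIV. \<Sum>l\<in>UNIV. cs (b k l) (if k = l then \<xi> n else 0))"
    by (intro asym_sum asym_cs iso)
  ultimately show ?thesis by simp
qed

section \<open>Slices of contractions along an orthogonal family\<close>

locale orth_family =
  fixes I :: "'i set" and a :: "'i \<Rightarrow> 'j::finite \<Rightarrow> 'j \<Rightarrow> complex" and lam :: real
  assumes finI: "finite I" and lam_pos: "lam > 0"
    and orth: "\<And>i i'. i \<in> I \<Longrightarrow> i' \<in> I \<Longrightarrow>
      (\<Sum>j\<in>UNIV. \<Sum>k\<in>UNIV. cnj (a i j k) * a i' j k) = (if i = i' then of_real lam else 0)"
begin

text \<open>The slice map Tr(a_i^* x) applied to the first tensor factor of X; this is Y_i.\<close>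

definition pairing :: "('j \<Rightarrow> 'j \<Rightarrow> fmat) \<Rightarrow> 'i \<Rightarrow> fmat" where
  "pairing X i = (\<Sum>j\<in>UNIV. \<Sum>k\<in>UNIV. cs (cnj (a i j k)) (X j k))"

text \<open>The orthogonal projection of X onto the block matrices \<Sum> a_i \<otimes> w_i, with
  w_i = Y_i / lam.\<close>

definition proj :: "('j \<Rightarrow> 'j \<Rightarrow> fmat) \<Rightarrow> 'j \<Rightarrow> 'j \<Rightarrow> fmat" where
  "proj X j k = (\<Sum>i\<in>I. cs (a i j k) (cs (1 / of_real lam) (pairing X i)))"

lemma bop_pairing: "(\<And>n. contr (X n)) \<Longrightarrow> bop (\<lambda>n. pairing (X n) i)"
  unfolding pairing_def by (intro bop_sum bop_cs bop_contr)

lemma bop_proj: "(\<And>n. contr (X n)) \<Longrightarrow> bop (\<lambda>n. proj (X n) j k)"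
  unfolding proj_def by (intro bop_sum bop_cs bop_pairing)

lemma proj_defect:
  "(\<Sum>j\<in>UNIV. \<Sum>k\<in>UNIV. (norm (X j k * \<xi> - proj X j k * \<xi>))\<^sup>2)
   = (\<Sum>j\<in>UNIV. \<Sum>k\<in>UNIV. (norm (X j k * \<xi>))\<^sup>2) - (\<Sum>i\<in>I. (norm (pairing X i * \<xi>))\<^sup>2) / lam"
proof -
  \<comment> \<open>The Bessel identity is used with the pairs (j, k) as its single index, so double
    sums are rewritten as sums over pairs.\<close>
  have p: "pairing X i * \<xi> = (\<Sum>x\<in>UNIV. cs (cnj (case x of (j, k) \<Rightarrow> a i j k)) (case x of (j, k) \<Rightarrow> X j k * \<xi>))" for i
    unfolding pairing_def sum_distrib_right cs_mult_left
    by (subst UNIV_Times_UNIV[symmetric], subst sum.cartesian_product) (rule sum.cong, auto)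
  have o: "(\<Sum>x\<in>UNIV. cnj (case x of (j, k) \<Rightarrow> a i j k) * (case x of (j, k) \<Rightarrow> a i' j k)) = (if i = i' then of_real lam else 0)"
    if "i \<in> I" "i' \<in> I" for i i'
    unfolding orth[OF that, symmetric]
    by (subst UNIV_Times_UNIV[symmetric], subst sum.cartesian_product) (rule sum.cong, auto)
  note * = bessel_defect[where a = "\<lambda>i x. case x of (j, k) \<Rightarrow> a i j k" and P = "\<lambda>x. case x of (j, k) \<Rightarrow> X j k * \<xi>"
      and p = "\<lambda>i. pairing X i * \<xi>", OF finI lam_pos o p]
  have r: "proj X j k * \<xi> = (\<Sum>i\<in>I. cs (a i j k / of_real lam) (pairing X i * \<xi>))" for j k
    by (simp add: proj_def sum_distrib_right cs_mult_left)
  show ?thesis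
    using * by (simp add: r UNIV_Times_UNIV[symmetric] sum.cartesian_product' case_prod_unfold del: UNIV_Times_UNIV)
qed

text \<open>Two estimates are chained: \<Sum> |Y_i \<xi>|^2 / lam \<le> \<Sum> |X_jk \<xi>|^2 by
  Bessel, and the latter is at most N because each block column of X is contractive.\<close>

lemma pairing_bound:
  assumes "contr X" "norm \<xi> = 1"
  shows "(\<Sum>j\<in>UNIV. \<Sum>k\<in>UNIV. (norm (X j k * \<xi>))\<^sup>2) \<le> real CARD('j)"
    and "(\<Sum>i\<in>I. (norm (pairing X i * \<xi>))\<^sup>2) \<le> lam * real CARD('j)"
proof -
  have "(\<Sum>j\<in>UNIV. \<Sum>k\<in>UNIV. (norm (X j k * \<xi>))\<^sup>2) \<le> (\<Sum>k\<in>(UNIV :: 'j set). (norm \<xi>)\<^sup>2)"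
    by (subst sum.swap) (intro sum_mono contr_column assms)
  then show 1: "(\<Sum>j\<in>UNIV. \<Sum>k\<in>UNIV. (norm (X j k * \<xi>))\<^sup>2) \<le> real CARD('j)"
    using assms(2) by simp
  have "0 \<le> (\<Sum>j\<in>UNIV. \<Sum>k\<in>UNIV. (norm (X j k * \<xi> - proj X j k * \<xi>))\<^sup>2)" by (intro sum_nonneg) auto
  then show "(\<Sum>i\<in>I. (norm (pairing X i * \<xi>))\<^sup>2) \<le> lam * real CARD('j)"
    using 1 lam_pos unfolding proj_defect by (simp add: pos_divide_le_eq mult.commute) (smt (verit) mult_left_mono)
qed

text \<open>If the chain of \<open>pairing_bound\<close> is saturated in the limit, both of its
  estimates are. The total defect \<open>?d\<close> dominates the Bessel defect, which gives the
  first claim, and the isometry defect, which gives the second.\<close>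

lemma extremal_sequence:
  assumes X: "\<And>n. contr (X n)" and "\<And>n. norm (\<xi> n) = 1"
    and lim: "(\<lambda>n. \<Sum>i\<in>I. (norm (pairing (X n) i * \<xi> n))\<^sup>2) \<longlonglongrightarrow> lam * real CARD('j)"
  shows "(\<lambda>n. X n j k * \<xi> n) \<approxeq> (\<lambda>n. proj (X n) j k * \<xi> n)"
    and "(\<lambda>n. \<Sum>j\<in>UNIV. adj (X n j k) * X n j l * \<xi> n) \<approxeq> (\<lambda>n. if k = l then \<xi> n else 0)"
proof -
  let ?d = "\<lambda>n. real CARD('j) - (\<Sum>i\<in>I. (norm (pairing (X n) i * \<xi> n))\<^sup>2) / lam"
  have d: "?d \<longlonglongrightarrow> 0"
    using tendsto_diff[OF tendsto_const tendsto_divide[OF lim tendsto_const, of lam], of "real CARD('j)"] lam_pos by simp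
  show "(\<lambda>n. X n j k * \<xi> n) \<approxeq> (\<lambda>n. proj (X n) j k * \<xi> n)"
  proof (rule asym_eqI_bound[OF d])
    fix n
    have "(norm (X n j k * \<xi> n - proj (X n) j k * \<xi> n))\<^sup>2 \<le> (\<Sum>k\<in>UNIV. (norm (X n j k * \<xi> n - proj (X n) j k * \<xi> n))\<^sup>2)"
      by (rule member_le_sum) auto
    also have "\<dots> \<le> (\<Sum>j\<in>UNIV. \<Sum>k\<in>UNIV. (norm (X n j k * \<xi> n - proj (X n) j k * \<xi> n))\<^sup>2)"
      by (rule member_le_sum[of j UNIV "\<lambda>j. \<Sum>k\<in>UNIV. (norm (X n j k * \<xi> n - proj (X n) j k * \<xi> n))\<^sup>2"]) (auto intro: sum_nonneg)
    also have "\<dots> \<le> ?d n" unfolding proj_defect using pairing_bound(1)[OF X assms(2)] by simp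
    finally show "(norm (X n j k * \<xi> n - proj (X n) j k * \<xi> n))\<^sup>2 \<le> ?d n" .
  qed
  show "(\<lambda>n. \<Sum>j\<in>UNIV. adj (X n j k) * X n j l * \<xi> n) \<approxeq> (\<lambda>n. if k = l then \<xi> n else 0)"
  proof (rule asym_eqI_bound[OF d])
    fix n
    let ?D = "\<lambda>k l. (norm ((\<Sum>j\<in>UNIV. adj (X n j k) * X n j l * \<xi> n) - (if k = l then \<xi> n else 0)))\<^sup>2"
    have "?D k l \<le> (\<Sum>l\<in>UNIV. ?D k l)" by (rule member_le_sum) auto
    also have "\<dots> \<le> (\<Sum>k\<in>UNIV. \<Sum>l\<in>UNIV. ?D k l)"
      by (rule member_le_sum[of k UNIV "\<lambda>k. \<Sum>l\<in>UNIV. ?D k l"]) (auto intro: sum_nonneg)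
    also have "\<dots> \<le> real CARD('j) - (\<Sum>j\<in>UNIV. \<Sum>l\<in>UNIV. (norm (X n j l * \<xi> n))\<^sup>2)"
      by (rule contr_isometry_defect[OF X assms(2)])
    also have "\<dots> \<le> ?d n"
    proof -
      have "0 \<le> (\<Sum>j\<in>UNIV. \<Sum>k\<in>UNIV. (norm (X n j k * \<xi> n - proj (X n) j k * \<xi> n))\<^sup>2)" by (intro sum_nonneg) auto
      then show ?thesis unfolding proj_defect by simp
    qed
    finally show "?D k l \<le> ?d n" .
  qed
qed

text \<open>Allows all estimates to be applied to X^* as well, on the side of \<eta>.\<close>

lemma orth_family_adj: "orth_family I (\<lambda>i j k. cnj (a i k j)) lam"
proof
  fix i i' assume "i \<in> I" "i' \<in> I"
  then show "(\<Sum>j\<in>UNIV. \<Sum>k\<in>UNIV. cnj (cnj (a i k j)) * cnj (a i' k j)) = (if i = i' then of_real lam else 0)"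
    using orth[of i' i] by (subst sum.swap) (auto simp: mult.commute)
qed (use finI lam_pos in auto)

end

text \<open>The indices of the final contradiction. In the limit \<open>dual_pq\<close> gives w_p^*
  w_q \<xi> = 0, \<open>dual_qq\<close> makes w_q^* w_q \<xi> a nonzero multiple of \<xi>, and
  \<open>dual_pp\<close>, stated for the adjoint family, makes w_p w_p^* \<eta> a nonzero multiple
  of \<eta>.\<close>

locale rigid_family = orth_family I a lam
  for I :: "'i set" and a :: "'i \<Rightarrow> 'j::finite \<Rightarrow> 'j \<Rightarrow> complex" and lam :: real +
  fixes p q :: 'i
  assumes pI: "p \<in> I" and qI: "q \<in> I"
    and dual_pq: "dual_coeff I a p q 0"
    and dual_qq: "\<exists>c. c \<noteq> 0 \<and> dual_coeff I a q q c"
    and dual_pp: "\<exists>c. c \<noteq> 0 \<and> dual_coeff I (\<lambda>i j k. cnj (a i k j)) p p c"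
begin

sublocale adj: orth_family I "\<lambda>i j k. cnj (a i k j)" lam
  by (rule orth_family_adj)

lemma adj_pairing: "adj.pairing (\<lambda>j k. adj (X k j)) i = adj (pairing X i)"
  unfolding pairing_def adj.pairing_def adj_sum adj_cs by (subst sum.swap) simp

lemma adj_proj: "adj.proj (\<lambda>j k. adj (X k j)) j k = adj (proj X k j)"
  unfolding proj_def adj.proj_def adj_pairing adj_sum adj_cs by simp

lemma no_extremal_sequence:
  assumes X: "\<And>n. contr (X n)"
    and n\<xi>: "\<And>n. norm (\<xi> n) = 1" and n\<eta>: "\<And>n. norm (\<eta> n) = 1"
    and s\<xi>: "\<And>n. adj (\<xi> n) = \<xi> n" and s\<eta>: "\<And>n. adj (\<eta> n) = \<eta> n"
    and lim: "f \<longlonglongrightarrow> lam * real CARD('j)"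
      "\<And>n. f n \<le> (\<Sum>i\<in>I. inner (pairing (X n) i * \<xi> n) (\<eta> n * pairing (X n) i))"
  shows False
proof -
  define Y where "Y n i = pairing (X n) i" for n i
  define W where "W n i = cs (1 / of_real lam) (Y n i)" for n i
  define u where "u n = proj (X n)" for n
  define Xa where "Xa n = (\<lambda>j k. adj (X n k j))" for n
  let ?N = "lam * real CARD('j)"
  let ?S = "\<lambda>n. \<Sum>i\<in>I. inner (Y n i * \<xi> n) (\<eta> n * Y n i)"
  let ?A = "\<lambda>n. \<Sum>i\<in>I. (norm (Y n i * \<xi> n))\<^sup>2"
  let ?B = "\<lambda>n. \<Sum>i\<in>I. (norm (adj (Y n i) * \<eta> n))\<^sup>2"
  let ?D = "\<lambda>n. \<Sum>i\<in>I. (norm (Y n i * \<xi> n - \<eta> n * Y n i))\<^sup>2"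
  have Xa: "contr (Xa n)" for n unfolding Xa_def by (rule contr_adj[OF X])
  have A: "?A n \<le> ?N" for n unfolding Y_def by (rule pairing_bound(2)[OF X n\<xi>])
  have B: "?B n \<le> ?N" for n
    using adj.pairing_bound(2)[OF Xa n\<eta>, of n n] by (simp add: Xa_def adj_pairing Y_def)
  have nB: "norm (adj (Y n i) * \<eta> n) = norm (\<eta> n * Y n i)" for n i
    using norm_adj[of "\<eta> n * Y n i"] by (simp add: adj_mult s\<eta> del: norm_adj)
  \<comment> \<open>Expanding the squares measures how far Cauchy-Schwarz is from equality in the
    sum \<open>?S\<close>.\<close>
  have D: "?D n = ?A n + ?B n - 2 * ?S n" for n
    unfolding nB sum_distrib_left sum.distrib[symmetric] sum_subtractf[symmetric]
    by (intro sum.cong refl) (simp add: power2_norm_eq_inner algebra_simps inner_commute)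
  have D0: "0 \<le> ?D n" for n by (intro sum_nonneg) auto
  have S: "?S \<longlonglongrightarrow> ?N"
  proof (rule tendsto_sandwich[OF _ _ lim(1) tendsto_const])
    show "\<forall>\<^sub>F n in sequentially. f n \<le> ?S n" using lim(2) by (simp add: Y_def)
    have "?S n \<le> ?N" for n using A[of n] B[of n] D[of n] D0[of n] by linarith
    then show "\<forall>\<^sub>F n in sequentially. ?S n \<le> ?N" by simp
  qed
  \<comment> \<open>Both \<open>?A\<close> and \<open>?B\<close> are at most \<open>?N\<close>, and
    \<open>?D\<close> is nonnegative, so each of them lies between 2 S - N and N.\<close>
  have lo: "(\<lambda>n. 2 * ?S n - ?N) \<longlonglongrightarrow> ?N"
    using tendsto_diff[OF tendsto_mult[OF tendsto_const S, of 2] tendsto_const, of ?N] by simp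
  have limA: "?A \<longlonglongrightarrow> ?N"
    by (rule tendsto_sandwich[OF _ _ lo tendsto_const], rule always_eventually)
       (use A B D D0 in \<open>auto intro!: always_eventually, smt (verit)\<close>)
  have limB: "?B \<longlonglongrightarrow> ?N"
    by (rule tendsto_sandwich[OF _ _ lo tendsto_const], rule always_eventually)
       (use A B D D0 in \<open>auto intro!: always_eventually, smt (verit)\<close>)
  have limD: "?D \<longlonglongrightarrow> 0"
    unfolding D using tendsto_diff[OF tendsto_add[OF limA limB] tendsto_mult[OF tendsto_const S, of 2]] by simp
  have Y: "(\<lambda>n. Y n i * \<xi> n) \<approxeq> (\<lambda>n. \<eta> n * Y n i)" if "i \<in> I" for i
    by (rule asym_eqI_bound[OF limD]) (rule member_le_sum[OF that], use finI in auto)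
  have W: "(\<lambda>n. W n i * \<xi> n) \<approxeq> (\<lambda>n. \<eta> n * W n i)" if "i \<in> I" for i
    unfolding W_def cs_mult_left cs_mult_right by (intro asym_cs Y that)
  have bX: "bop (\<lambda>n. X n j k)" for j k by (intro bop_contr X)
  have bW: "bop (\<lambda>n. W n i)" for i
    unfolding W_def Y_def by (intro bop_cs bop_pairing X)
  have bu: "bop (\<lambda>n. u n j k)" for j k unfolding u_def by (intro bop_proj X)
  have u: "u n j k = (\<Sum>i\<in>I. cs (a i j k) (W n i))" for n j k
    by (simp add: u_def proj_def W_def Y_def)
  have Xu: "(\<lambda>n. X n j k * \<xi> n) \<approxeq> (\<lambda>n. u n j k * \<xi> n)" for j k
    unfolding u_def by (rule extremal_sequence(1)[OF X n\<xi>]) (use limA in \<open>simp add: Y_def\<close>)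
  have iso: "(\<lambda>n. \<Sum>j\<in>UNIV. adj (X n j k) * X n j l * \<xi> n) \<approxeq> (\<lambda>n. if k = l then \<xi> n else 0)" for k l
    by (rule extremal_sequence(2)[OF X n\<xi>]) (use limA in \<open>simp add: Y_def\<close>)
  have limB': "(\<lambda>n. \<Sum>i\<in>I. (norm (adj.pairing (Xa n) i * \<eta> n))\<^sup>2) \<longlonglongrightarrow> ?N"
    using limB by (simp add: Xa_def adj_pairing Y_def)
  have Xu': "(\<lambda>n. adj (X n j k) * \<eta> n) \<approxeq> (\<lambda>n. adj (u n j k) * \<eta> n)" for j k
    using adj.extremal_sequence(1)[OF Xa n\<eta> limB', of k j] by (simp add: Xa_def adj_proj u_def)
  have iso': "(\<lambda>n. \<Sum>j\<in>UNIV. X n k j * adj (X n l j) * \<eta> n) \<approxeq> (\<lambda>n. if k = l then \<eta> n else 0)" for k l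
    using adj.extremal_sequence(2)[OF Xa n\<eta> limB', of k l] by (simp add: Xa_def)
  have ux: "(\<lambda>n. u n j k * \<xi> n) \<approxeq> (\<lambda>n. \<eta> n * u n j k)" for j k
    unfolding u sum_distrib_right sum_distrib_left cs_mult_left cs_mult_right
    by (intro asym_sum asym_cs W)
  have ux': "(\<lambda>n. adj (u n j k) * \<eta> n) \<approxeq> (\<lambda>n. \<xi> n * adj (u n j k))" for j k
    using asym_sym[OF asym_adj[OF ux[of j k]]] by (simp add: adj_mult s\<xi> s\<eta>)
  \<comment> \<open>The relation X \<xi> \<approxeq> u \<xi> replaces only the right factor of X^* X
    \<xi>. Commuting \<xi> past u turns it into \<eta> next to X^*, where X^* \<eta> \<approxeq> u^*
    \<eta> replaces the left factor; then \<eta> is moved back.\<close>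
  have iso_u: "(\<lambda>n. \<Sum>j\<in>UNIV. adj (u n j k) * u n j l * \<xi> n) \<approxeq> (\<lambda>n. if k = l then \<xi> n else 0)" for k l
  proof (rule asym_trans[OF asym_sym iso], rule asym_sum)
    fix j
    have "(\<lambda>n. adj (X n j k) * (X n j l * \<xi> n)) \<approxeq> (\<lambda>n. adj (X n j k) * (u n j l * \<xi> n))"
      by (intro asym_mult_left bop_adj bX Xu)
    also have "\<dots> \<approxeq> (\<lambda>n. adj (X n j k) * (\<eta> n * u n j l))"
      by (intro asym_mult_left bop_adj bX ux)
    also have "\<dots> = (\<lambda>n. adj (X n j k) * \<eta> n * u n j l)" by (simp add: mult.assoc)
    also have "\<dots> \<approxeq> (\<lambda>n. adj (u n j k) * \<eta> n * u n j l)"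
      by (intro asym_mult_right bu Xu')
    also have "\<dots> = (\<lambda>n. adj (u n j k) * (\<eta> n * u n j l))" by (simp add: mult.assoc)
    also have "\<dots> \<approxeq> (\<lambda>n. adj (u n j k) * (u n j l * \<xi> n))"
      by (intro asym_mult_left bop_adj bu asym_sym[OF ux])
    finally show "(\<lambda>n. adj (X n j k) * X n j l * \<xi> n) \<approxeq> (\<lambda>n. adj (u n j k) * u n j l * \<xi> n)"
      by (simp add: mult.assoc)
  qed
  have iso_u': "(\<lambda>n. \<Sum>j\<in>UNIV. u n k j * adj (u n l j) * \<eta> n) \<approxeq> (\<lambda>n. if k = l then \<eta> n else 0)" for k l
  proof (rule asym_trans[OF asym_sym iso'], rule asym_sum)
    fix j
    have "(\<lambda>n. X n k j * (adj (X n l j) * \<eta> n)) \<approxeq> (\<lambda>n. X n k j * (adj (u n l j) * \<eta> n))"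
      by (intro asym_mult_left bX Xu')
    also have "\<dots> \<approxeq> (\<lambda>n. X n k j * (\<xi> n * adj (u n l j)))"
      by (intro asym_mult_left bX ux')
    also have "\<dots> = (\<lambda>n. X n k j * \<xi> n * adj (u n l j))" by (simp add: mult.assoc)
    also have "\<dots> \<approxeq> (\<lambda>n. u n k j * \<xi> n * adj (u n l j))"
      by (intro asym_mult_right bop_adj bu Xu)
    also have "\<dots> = (\<lambda>n. u n k j * (\<xi> n * adj (u n l j)))" by (simp add: mult.assoc)
    also have "\<dots> \<approxeq> (\<lambda>n. u n k j * (adj (u n l j) * \<eta> n))"
      by (intro asym_mult_left bu asym_sym[OF ux'])
    finally show "(\<lambda>n. X n k j * adj (X n l j) * \<eta> n) \<approxeq> (\<lambda>n. u n k j * adj (u n l j) * \<eta> n)"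
      by (simp add: mult.assoc)
  qed
  obtain c c' where c: "c \<noteq> 0" "dual_coeff I a q q c"
    and c': "c' \<noteq> 0" "dual_coeff I (\<lambda>i j k. cnj (a i k j)) p p c'"
    using dual_qq dual_pp by blast
  have pq: "(\<lambda>n. adj (W n p) * W n q * \<xi> n) \<approxeq> (\<lambda>n. cs 0 (\<xi> n))"
    by (rule dual_coeff_asym[OF finI pI qI dual_pq u iso_u])
  have qq: "(\<lambda>n. adj (W n q) * W n q * \<xi> n) \<approxeq> (\<lambda>n. cs c (\<xi> n))"
    by (rule dual_coeff_asym[OF finI qI qI c(2) u iso_u])
  \<comment> \<open>The same extraction for the adjoint family, whose coefficients are the adjoints
    of the W_i.\<close>
  have pp: "(\<lambda>n. W n p * adj (W n p) * \<eta> n) \<approxeq> (\<lambda>n. cs c' (\<eta> n))"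
  proof -
    have "adj (u n k j) = (\<Sum>i\<in>I. cs (cnj (a i k j)) (adj (W n i)))" for n j k
      by (simp add: u adj_sum adj_cs)
    moreover have "(\<lambda>n. \<Sum>j\<in>UNIV. adj (adj (u n k j)) * adj (u n l j) * \<eta> n) \<approxeq> (\<lambda>n. if k = l then \<eta> n else 0)" for k l
      using iso_u' by simp
    ultimately show ?thesis
      using dual_coeff_asym[OF finI pI pI c'(2), of "\<lambda>n j k. adj (u n k j)" "\<lambda>n i. adj (W n i)" \<eta>] by simp
  qed
  \<comment> \<open>The chain c' \<eta> w_q \<approxeq> w_p w_p^* \<eta> w_q \<approxeq> w_p w_p^*
    w_q \<xi> \<approxeq> 0 forces w_q \<xi> to vanish asymptotically.\<close>
  have "(\<lambda>n. cs c' (\<eta> n * W n q)) \<approxeq> (\<lambda>n. cs c' (\<eta> n) * W n q)" by (simp add: cs_mult_left asym_refl)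
  also have "\<dots> \<approxeq> (\<lambda>n. W n p * adj (W n p) * \<eta> n * W n q)"
    by (intro asym_mult_right bW asym_sym[OF pp])
  also have "\<dots> = (\<lambda>n. W n p * (adj (W n p) * (\<eta> n * W n q)))" by (simp add: mult.assoc)
  also have "\<dots> \<approxeq> (\<lambda>n. W n p * (adj (W n p) * (W n q * \<xi> n)))"
    by (intro asym_mult_left bop_adj bW asym_sym[OF W] qI)
  also have "\<dots> = (\<lambda>n. W n p * (adj (W n p) * W n q * \<xi> n))" by (simp add: mult.assoc)
  also have "\<dots> \<approxeq> (\<lambda>n. W n p * cs 0 (\<xi> n))" by (intro asym_mult_left bW pq)
  finally have "(\<lambda>n. cs (1 / c') (cs c' (\<eta> n * W n q))) \<approxeq> (\<lambda>n. cs (1 / c') 0)" by (intro asym_cs) simp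
  then have "(\<lambda>n. \<eta> n * W n q) \<approxeq> (\<lambda>n. 0)" using c'(1) by simp
  then have W0: "(\<lambda>n. W n q * \<xi> n) \<approxeq> (\<lambda>n. 0)" by (rule asym_trans[OF W[OF qI]])
  \<comment> \<open>Now c \<xi> \<approxeq> w_q^* w_q \<xi> \<approxeq> 0, although c \<xi> has
    constant norm |c| > 0.\<close>
  have "(\<lambda>n. cs c (\<xi> n)) \<approxeq> (\<lambda>n. adj (W n q) * (W n q * \<xi> n))"
    using asym_sym[OF qq] by (simp add: mult.assoc)
  also have "\<dots> \<approxeq> (\<lambda>n. adj (W n q) * 0)" by (intro asym_mult_left bop_adj bW W0)
  finally have "(\<lambda>n. cmod c) \<longlonglongrightarrow> 0" by (simp add: asym_eq_def norm_cs n\<xi>)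
  then show False using c(1) by (simp add: LIMSEQ_const_iff)
qed


section \<open>The completely positive map of the slices and its norm gap\<close>

definition cp_map :: "('j \<Rightarrow> 'j \<Rightarrow> fmat) \<Rightarrow> fmat \<Rightarrow> fmat" where
  "cp_map X \<xi> = (\<Sum>i\<in>I. pairing X i * \<xi> * adj (pairing X i))"

lemma cp_map_add: "cp_map X (\<xi> + \<eta>) = cp_map X \<xi> + cp_map X \<eta>"
  by (simp add: cp_map_def distrib_left distrib_right sum.distrib)

lemma cp_map_cs: "cp_map X (cs c \<xi>) = cs c (cp_map X \<xi>)"
  by (simp add: cp_map_def cs_mult_left cs_mult_right cs_sum)

lemma adj_cp_map: "adj (cp_map X \<xi>) = cp_map X (adj \<xi>)"
  by (simp add: cp_map_def adj_sum adj_mult mult.assoc)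

text \<open>If no e works, there are contractions and self-adjoint unit vectors \<xi> whose images
  have norms tending to at least lam N. With \<eta> the normalised image of \<xi> this is the
  excluded extremal sequence.\<close>

lemma cp_map_gap_selfadjoint:
  "\<exists>e>0. \<forall>X \<xi>. contr X \<longrightarrow> adj \<xi> = \<xi> \<longrightarrow> norm (cp_map X \<xi>) \<le> (lam * real CARD('j) - e) * norm \<xi>"
proof (rule ccontr)
  let ?N = "lam * real CARD('j)"
  assume neg: "\<not> ?thesis"
  have N: "?N > 0" using lam_pos by simp
  \<comment> \<open>The denominators 2 + n keep the lower bound \<open>f n\<close> below positive
    for every n, including n = 0, so the images can be normalised.\<close>
  have "\<exists>X \<xi>. contr X \<and> adj \<xi> = \<xi> \<and> (?N - ?N / (2 + real n)) * norm \<xi> < norm (cp_map X \<xi>)" for n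
  proof -
    have "?N / (2 + real n) > 0" using N by (intro divide_pos_pos) auto
    then show ?thesis using neg by (meson not_le)
  qed
  then obtain X \<zeta> where X: "\<And>n. contr (X n)" and s: "\<And>n. adj (\<zeta> n) = \<zeta> n"
    and gt: "\<And>n. (?N - ?N / (2 + real n)) * norm (\<zeta> n) < norm (cp_map (X n) (\<zeta> n))"
    by metis
  define f where "f n = ?N - ?N / (2 + real n)" for n
  have "0 < M - M / (2 + real n)" if "M > 0" for M n
    using that by (simp add: field_simps add_pos_nonneg)
  then have f0: "f n > 0" for n using N by (simp add: f_def)
  have \<zeta>0: "\<zeta> n \<noteq> 0" for n
    using gt[of n] by (auto simp: cp_map_def)
  define \<xi> where "\<xi> n = cs (of_real (1 / norm (\<zeta> n))) (\<zeta> n)" for n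
  define \<eta> where "\<eta> n = cs (of_real (1 / norm (cp_map (X n) (\<xi> n)))) (cp_map (X n) (\<xi> n))" for n
  have \<xi>: "norm (\<xi> n) = 1" "adj (\<xi> n) = \<xi> n" for n
    using \<zeta>0[of n] s by (auto simp: \<xi>_def norm_cs norm_divide adj_cs)
  have gt': "f n < norm (cp_map (X n) (\<xi> n))" for n
    using gt[of n] \<zeta>0[of n] by (simp add: \<xi>_def cp_map_cs norm_cs norm_divide f_def field_simps)
  then have nz: "cp_map (X n) (\<xi> n) \<noteq> 0" for n using f0[of n] by (metis norm_zero order.asym)
  have \<eta>: "norm (\<eta> n) = 1" "adj (\<eta> n) = \<eta> n" for n
    using nz[of n] \<xi>(2) by (auto simp: \<eta>_def norm_cs norm_divide adj_cs adj_cp_map)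
  show False
  proof (rule no_extremal_sequence[of X \<xi> \<eta> f])
    show "f \<longlonglongrightarrow> ?N"
      unfolding f_def
      by (rule tendsto_eq_rhs[OF tendsto_diff[OF tendsto_const tendsto_divide_0[OF tendsto_const]]])
         (auto intro!: filterlim_at_top_imp_at_infinity filterlim_tendsto_add_at_top[OF tendsto_const] filterlim_real_sequentially)
    fix n
    \<comment> \<open>Moving the right factor Y_i^* across gives <Y_i \<xi> Y_i^*, \<eta>> = <Y_i
      \<xi>, \<eta> Y_i>.\<close>
    have "(\<Sum>i\<in>I. inner (pairing (X n) i * \<xi> n) (\<eta> n * pairing (X n) i)) = inner (cp_map (X n) (\<xi> n)) (\<eta> n)"
      by (simp add: cp_map_def inner_sum_left inner_mult_right[of "_ * _"])
    also have "\<dots> = norm (cp_map (X n) (\<xi> n))"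
      using nz[of n] unfolding \<eta>_def scaleR_fmat_def[symmetric]
      by (simp add: power2_norm_eq_inner[symmetric] power2_eq_square)
    finally show "f n \<le> (\<Sum>i\<in>I. inner (pairing (X n) i * \<xi> n) (\<eta> n * pairing (X n) i))"
      using gt'[of n] by simp
  qed (use X \<xi> \<eta> in auto)
qed

text \<open>A Hermitian-preserving map attains its Hilbert-Schmidt norm on self-adjoint matrices.\<close>

lemma cp_map_gap:
  "\<exists>K. 0 \<le> K \<and> K < lam * real CARD('j) \<and> (\<forall>X \<xi>. contr X \<longrightarrow> norm (cp_map X \<xi>) \<le> K * norm \<xi>)"
proof -
  obtain e where e: "e > 0"
    and sa: "\<And>X \<xi>. contr X \<Longrightarrow> adj \<xi> = \<xi> \<Longrightarrow> norm (cp_map X \<xi>) \<le> (lam * real CARD('j) - e) * norm \<xi>"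
    using cp_map_gap_selfadjoint by blast
  \<comment> \<open>Shrinking e keeps the constant lam N - e' nonnegative, as squaring the estimate
    requires.\<close>
  define e' where "e' = min e (lam * real CARD('j))"
  have e': "e' > 0" "0 \<le> lam * real CARD('j) - e'" "e' \<le> e"
    using e lam_pos by (auto simp: e'_def)
  have sa': "norm (cp_map X \<xi>) \<le> (lam * real CARD('j) - e') * norm \<xi>" if "contr X" "adj \<xi> = \<xi>" for X \<xi>
    using sa[OF that] mult_right_mono[of "lam * real CARD('j) - e" "lam * real CARD('j) - e'" "norm \<xi>"] e'(3)
    by simp
  \<comment> \<open>The isometry \<open>adj\<close> fixes A and negates \<i> B, so these two are
    orthogonal in the real inner product.\<close>
  have pyth: "(norm (A + cs \<i> B))\<^sup>2 = (norm A)\<^sup>2 + (norm B)\<^sup>2" if "adj A = A" "adj B = B" for A B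
  proof -
    have "inner A (cs \<i> B) = inner (adj A) (adj (cs \<i> B))" by (simp add: inner_adj_adj)
    also have "\<dots> = inner A (- cs \<i> B)" using that by (simp add: adj_cs cs_minus)
    finally have "inner A (cs \<i> B) = 0" by simp
    then have "(norm (A + cs \<i> B))\<^sup>2 = (norm A)\<^sup>2 + (norm (cs \<i> B))\<^sup>2"
      by (simp add: power2_norm_eq_inner algebra_simps inner_commute)
    then show ?thesis by (simp add: norm_cs)
  qed
  show ?thesis
  proof (intro exI[of _ "lam * real CARD('j) - e'"] conjI allI impI)
    fix X \<xi> assume X: "contr (X :: 'j \<Rightarrow> 'j \<Rightarrow> fmat)"
    define K where "K = lam * real CARD('j) - e'"
    define A where "A = cs (1 / 2) (\<xi> + adj \<xi>)"
    define B where "B = cs (- \<i> / 2) (\<xi> - adj \<xi>)"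
    have A: "adj A = A" by (rule fmat_eqI) (simp add: A_def add.commute)
    have B: "adj B = B" by (simp add: B_def adj_cs adj_diff cs_diff cs_minus)
    have "cs \<i> B = cs (1 / 2) (\<xi> - adj \<xi>)" by (simp add: B_def)
    then have \<xi>: "\<xi> = A + cs \<i> B"
      unfolding A_def by (intro fmat_eqI) (simp add: add_divide_distrib diff_divide_distrib)
    have "(norm (cp_map X \<xi>))\<^sup>2 = (norm (cp_map X A))\<^sup>2 + (norm (cp_map X B))\<^sup>2"
      unfolding \<xi> cp_map_add cp_map_cs by (rule pyth) (simp_all add: adj_cp_map A B)
    also have "\<dots> \<le> (K * norm A)\<^sup>2 + (K * norm B)\<^sup>2"
      unfolding K_def by (intro add_mono power_mono sa' X A B) auto
    also have "\<dots> = (K * norm \<xi>)\<^sup>2"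
      unfolding \<xi> power_mult_distrib pyth[OF A B] by (simp add: algebra_simps)
    finally show "norm (cp_map X \<xi>) \<le> (lam * real CARD('j) - e') * norm \<xi>"
      unfolding K_def by (rule power2_le_imp_le) (use e' in simp)
  qed (use e' in simp_all)
qed

end

section \<open>The operator norm of block matrices\<close>

lemma ent_le_norm: "cmod (ent a r s) \<le> norm a"
proof -
  obtain n where n: "supp n a" by (meson ex_supp)
  show ?thesis
  proof (cases "r < n \<and> s < n")
    case True
    then show ?thesis
      unfolding norm_fmat_L2[OF n]
      using member_le_L2_set[of "{..<n} \<times> {..<n}" "(r, s)" "\<lambda>(i, j). cmod (ent a i j)"] by simp
  next
    case False
    then show ?thesis using n by (auto simp: supp_def not_less)
  qed
qed

lemma norm_le_sum_ent:
  assumes "supp n a"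
  shows "norm a \<le> (\<Sum>r<n. \<Sum>s<n. cmod (ent a r s))"
  unfolding norm_fmat_L2[OF assms] sum.cartesian_product
  by (rule order.trans[OF L2_set_le_sum]) (auto simp: case_prod_unfold)

lemma ent_mult_matrix_unit:
  assumes "supp n a" "r < n" "s < n"
  shows "ent (a * Fmat (\<lambda>i j. if i = s \<and> j = t then 1 else 0)) r t = ent a r s"
proof -
  have "ent (Fmat (\<lambda>i j. if i = s \<and> j = t then 1 else 0)) = (\<lambda>i j. if i = s \<and> j = t then 1 else 0)"
    by (rule ent_Fmat[of "Suc (max s t)"]) auto
  then show ?thesis
    using assms by (simp add: ent_mult[OF assms(1)] if_distrib cong: if_cong)
qed

definition munit :: "nat \<Rightarrow> nat \<Rightarrow> fmat" where
  "munit r s = Fmat (\<lambda>i j. if i = r \<and> j = s then 1 else 0)"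

lemma ent_munit [simp]: "ent (munit r s) i j = (if i = r \<and> j = s then 1 else 0)"
  unfolding munit_def by (subst ent_Fmat[of "Suc (max r s)"]) auto

lemma supp_munit: "r < n \<Longrightarrow> s < n \<Longrightarrow> supp n (munit r s)"
  by (auto simp: supp_def)

lemma norm_munit: "norm (munit r s) = 1"
proof -
  let ?n = "Suc (max r s)"
  have sq: "(if x = (r, s) then 1 else (0 :: real))\<^sup>2 = (if x = (r, s) then 1 else 0)" for x
    by simp
  have "norm (munit r s) = L2_set (\<lambda>x. if x = (r, s) then 1 else 0) ({..<?n} \<times> {..<?n})"
    by (subst norm_fmat_L2[of ?n]) (auto intro!: supp_munit L2_set_cong)
  also have "\<dots> = 1" unfolding L2_set_def sq by (simp add: less_Suc_eq_le)
  finally show ?thesis .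
qed

lemma norm_axis: "norm (axis k a :: 'a::real_inner ^ 'j::finite) = norm a"
  by (simp add: norm_eq_sqrt_inner inner_axis_axis)

section \<open>Block matrices as operators on tuples of Hilbert-Schmidt matrices\<close>

definition act :: "('j::finite \<Rightarrow> 'j \<Rightarrow> fmat) \<Rightarrow> fmat ^ 'j \<Rightarrow> fmat ^ 'j" where
  "act X h = (\<chi> j. \<Sum>k\<in>UNIV. X j k * h $ k)"

text \<open>Although taken over tuples of matrices, this is the usual operator norm of X as a block
  matrix, since matrix columns are acted on separately.\<close>

definition bnorm :: "('j::finite \<Rightarrow> 'j \<Rightarrow> fmat) \<Rightarrow> real" where
  "bnorm X = onorm (act X)"

definition bmult :: "('j::finite \<Rightarrow> 'j \<Rightarrow> fmat) \<Rightarrow> ('j \<Rightarrow> 'j \<Rightarrow> fmat) \<Rightarrow> 'j \<Rightarrow> 'j \<Rightarrow> fmat" where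
  "bmult X Y j l = (\<Sum>k\<in>UNIV. X j k * Y k l)"

definition badj :: "('j::finite \<Rightarrow> 'j \<Rightarrow> fmat) \<Rightarrow> 'j \<Rightarrow> 'j \<Rightarrow> fmat" where
  "badj X j k = adj (X k j)"

lemma norm_act_le: "norm (act X h) \<le> norm h * (\<Sum>j\<in>UNIV. \<Sum>k\<in>UNIV. norm (X j k))"
proof -
  have "norm (act X h) \<le> (\<Sum>j\<in>UNIV. norm (act X h $ j))" unfolding norm_vec_def by (rule L2_set_le_sum) auto
  also have "\<dots> \<le> (\<Sum>j\<in>UNIV. \<Sum>k\<in>UNIV. norm (X j k) * norm h)"
    unfolding act_def vec_lambda_beta
    by (intro sum_mono order.trans[OF norm_sum] order.trans[OF norm_mult_ineq] mult_left_mono Finite_Cartesian_Product.norm_nth_le) auto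
  finally show ?thesis by (simp add: sum_distrib_left mult.commute)
qed

lemma bounded_linear_act: "bounded_linear (act X)"
  by (rule bounded_linear_intro[OF _ _ norm_act_le])
     (auto simp: act_def vec_eq_iff distrib_left sum.distrib scaleR_sum_right)

lemma norm_act: "norm (act X h) \<le> bnorm X * norm h"
  unfolding bnorm_def by (rule onorm[OF bounded_linear_act])

lemma bnorm_le:
  assumes "\<And>h. norm (act X h) \<le> K * norm h"
  shows "bnorm X \<le> K"
  unfolding bnorm_def
proof (rule onorm_bound)
  \<comment> \<open>Testing on a unit vector forces K to be nonnegative; any block index serves,
    hence \<open>undefined\<close>.\<close>
  show "0 \<le> K"
    using order.trans[OF norm_ge_zero assms[of "axis undefined (munit 0 0)"]]
    by (simp add: norm_axis norm_munit)
qed (use assms in auto)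

lemma bnorm_nonneg: "0 \<le> bnorm X"
  unfolding bnorm_def by (rule onorm_pos_le[OF bounded_linear_act])

lemma bnorm_le_sum: "bnorm X \<le> (\<Sum>j\<in>UNIV. \<Sum>k\<in>UNIV. norm (X j k))"
  by (rule bnorm_le) (metis norm_act_le mult.commute)

lemma contr_bnorm:
  assumes "bnorm X \<le> 1"
  shows "contr X"
  unfolding contr_def
proof
  fix h :: "'a \<Rightarrow> fmat"
  have sq: "(norm v)\<^sup>2 = (\<Sum>j\<in>UNIV. (norm (v $ j))\<^sup>2)" for v :: "fmat ^ 'a"
    by (simp add: norm_vec_def L2_set_def sum_nonneg)
  have "norm (act X (\<chi> k. h k)) \<le> norm (\<chi> k. h k)"
    using norm_act[of X "\<chi> k. h k"] mult_right_mono[OF assms norm_ge_zero[of "\<chi> k. h k"]] by simp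
  then have "(norm (act X (\<chi> k. h k)))\<^sup>2 \<le> (norm (\<chi> k. h k))\<^sup>2" by (intro power_mono) auto
  then show "(\<Sum>j\<in>UNIV. (norm (\<Sum>k\<in>UNIV. X j k * h k))\<^sup>2) \<le> (\<Sum>k\<in>UNIV. (norm (h k))\<^sup>2)"
    unfolding sq by (simp add: act_def)
qed

text \<open>The entry appears in the image of the unit vector that carries a matrix unit in position
  k.\<close>

lemma norm_block_le:
  "cmod (ent (X j k) r s) \<le> bnorm X"
proof -
  let ?h = "axis k (munit s s) :: fmat ^ 'a"
  have a: "act X ?h $ j = X j k * munit s s"
  proof -
    have "X j l * ?h $ l = (if l = k then X j k * munit s s else 0)" for l by (simp add: axis_def)
    then show ?thesis by (simp add: act_def)
  qed
  obtain n where "supp n (X j k)" by (meson ex_supp)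
  then have n: "supp (Suc (max n (max r s))) (X j k)" by (rule supp_mono) auto
  have "ent (X j k) r s = ent (X j k * munit s s) r s"
    unfolding munit_def by (rule ent_mult_matrix_unit[OF n, symmetric]) auto
  then have "cmod (ent (X j k) r s) \<le> norm (act X ?h $ j)"
    unfolding a by (metis ent_le_norm)
  also have "\<dots> \<le> norm (act X ?h)" by (rule Finite_Cartesian_Product.norm_nth_le)
  also have "\<dots> \<le> bnorm X * norm ?h" by (rule norm_act)
  finally show ?thesis by (simp add: norm_axis norm_munit)
qed

lemma bnorm_eq_0D: "bnorm X = 0 \<Longrightarrow> X j k = 0"
  using norm_block_le[of X j k] by (intro fmat_eqI) simp

lemma bnorm_0: "bnorm (\<lambda>_ _. 0) = 0"
  by (rule order.antisym[OF order.trans[OF bnorm_le_sum] bnorm_nonneg]) simp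

lemma bnorm_triangle: "bnorm (\<lambda>j k. X j k + Y j k) \<le> bnorm X + bnorm Y"
proof (rule bnorm_le)
  fix h
  have "act (\<lambda>j k. X j k + Y j k) h = act X h + act Y h"
    by (simp add: act_def vec_eq_iff distrib_right sum.distrib)
  then show "norm (act (\<lambda>j k. X j k + Y j k) h) \<le> (bnorm X + bnorm Y) * norm h"
    using norm_triangle_mono[OF norm_act norm_act] by (simp add: distrib_right)
qed

lemma bnorm_cs_le: "bnorm (\<lambda>j k. cs c (X j k)) \<le> cmod c * bnorm X"
proof (rule bnorm_le)
  fix h
  have "norm (act (\<lambda>j k. cs c (X j k)) h) = cmod c * norm (act X h)"
    by (simp add: act_def cs_mult_left cs_sum[symmetric] norm_vec_def norm_cs L2_set_right_distrib)
  then show "norm (act (\<lambda>j k. cs c (X j k)) h) \<le> cmod c * bnorm X * norm h"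
    using mult_left_mono[OF norm_act[of X h], of "cmod c"] by (simp add: mult.assoc)
qed

lemma bnorm_cs: "bnorm (\<lambda>j k. cs c (X j k)) = cmod c * bnorm X"
proof (cases "c = 0")
  case False
  have "bnorm X \<le> cmod (1 / c) * bnorm (\<lambda>j k. cs c (X j k))"
    using bnorm_cs_le[of "1 / c" "\<lambda>j k. cs c (X j k)"] False by simp
  then have "cmod c * bnorm X \<le> bnorm (\<lambda>j k. cs c (X j k))"
    using False by (simp add: norm_divide field_simps)
  with bnorm_cs_le[of c X] show ?thesis by simp
qed (simp add: bnorm_0)

lemma act_bmult: "act (bmult X Y) h = act X (act Y h)"
proof -
  have "(\<Sum>l\<in>UNIV. (\<Sum>k\<in>UNIV. X j k * Y k l) * h $ l) = (\<Sum>k\<in>UNIV. X j k * (\<Sum>l\<in>UNIV. Y k l * h $ l))" for j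
    by (simp add: sum_distrib_left sum_distrib_right mult.assoc) (rule sum.swap)
  then show ?thesis by (simp add: act_def bmult_def vec_eq_iff)
qed

lemma bnorm_bmult: "bnorm (bmult X Y) \<le> bnorm X * bnorm Y"
proof (rule bnorm_le)
  fix h
  show "norm (act (bmult X Y) h) \<le> bnorm X * bnorm Y * norm h"
    unfolding act_bmult
    using order.trans[OF norm_act[of X "act Y h"] mult_left_mono[OF norm_act[of Y h] bnorm_nonneg[of X]]]
    by (simp add: mult.assoc)
qed

lemma inner_act: "inner (act X h) g = inner h (act (badj X) g)"
proof -
  have "inner (act X h) g = (\<Sum>j\<in>UNIV. \<Sum>k\<in>UNIV. inner (h $ k) (adj (X j k) * g $ j))"
    by (simp add: inner_vec_def act_def inner_sum_left inner_mult_left)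
  also have "\<dots> = inner h (act (badj X) g)"
    by (subst sum.swap) (simp add: inner_vec_def act_def badj_def inner_sum_right)
  finally show ?thesis .
qed

lemma badj_badj [simp]: "badj (badj X) = X"
  by (simp add: badj_def fun_eq_iff)

text \<open>From |X h|^2 = <h, X^* X h> and Cauchy-Schwarz.\<close>

lemma bnorm_sq_le: "(bnorm X)\<^sup>2 \<le> bnorm (bmult (badj X) X)"
proof -
  have "norm (act X h) \<le> sqrt (bnorm (bmult (badj X) X)) * norm h" for h
  proof (rule power2_le_imp_le)
    have "(norm (act X h))\<^sup>2 = inner h (act (bmult (badj X) X) h)"
      by (simp add: power2_norm_eq_inner inner_act act_bmult)
    also have "\<dots> \<le> norm h * (bnorm (bmult (badj X) X) * norm h)"
      by (rule order.trans[OF norm_cauchy_schwarz]) (intro mult_left_mono norm_act norm_ge_zero)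
    also have "\<dots> = (sqrt (bnorm (bmult (badj X) X)) * norm h)\<^sup>2"
      by (simp add: power_mult_distrib bnorm_nonneg power2_eq_square)
    finally show "(norm (act X h))\<^sup>2 \<le> (sqrt (bnorm (bmult (badj X) X)) * norm h)\<^sup>2" .
  qed (simp add: bnorm_nonneg)
  then have "bnorm X \<le> sqrt (bnorm (bmult (badj X) X))" by (rule bnorm_le)
  then show ?thesis using real_le_rsqrt bnorm_nonneg by (metis real_sqrt_le_iff real_sqrt_unique order.trans power_mono real_sqrt_pow2)
qed

text \<open>Cancel |X| in |X|^2 \<le> |X^* X| \<le> |X^*| |X|, then exchange X and X^*.\<close>

lemma bnorm_badj: "bnorm (badj X) = bnorm X"
proof -
  have *: "bnorm Y \<le> bnorm (badj Y)" for Y :: "'a \<Rightarrow> 'a \<Rightarrow> fmat"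
  proof (cases "bnorm Y = 0")
    case False
    have "bnorm Y * bnorm Y \<le> bnorm (badj Y) * bnorm Y"
      using order.trans[OF bnorm_sq_le bnorm_bmult] by (simp add: power2_eq_square)
    then show ?thesis using False bnorm_nonneg[of Y] by (simp add: mult_le_cancel_right)
  qed (simp add: bnorm_nonneg)
  show ?thesis using *[of X] *[of "badj X"] by simp
qed

lemma bnorm_cstar: "bnorm (bmult (badj X) X) = (bnorm X)\<^sup>2"
  using bnorm_sq_le[of X] bnorm_bmult[of "badj X" X] by (simp add: bnorm_badj power2_eq_square)

text \<open>Otherwise the powers of s / t > 1 would exceed K. This removes the constant from the
  comparison of two equivalent norms.\<close>

lemma le_of_pow2_le:
  fixes s t K :: real
  assumes "0 \<le> s" "0 \<le> t" and le: "\<And>k. s ^ (2 ^ k) \<le> K * t ^ (2 ^ k)"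
  shows "s \<le> t"
proof (rule ccontr)
  assume "\<not> s \<le> t"
  then have st: "t < s" by simp
  show False
  proof (cases "t = 0")
    case True
    then show ?thesis using le[of 0] st by simp
  next
    case False
    then have t: "t > 0" using assms by simp
    obtain n where n: "K < (s / t) ^ n" using real_arch_pow[of "s / t" K] st t by (auto simp: field_simps)
    have "(s / t) ^ n \<le> (s / t) ^ (2 ^ n)"
      using st t by (intro power_increasing) (auto simp: field_simps less_imp_le)
    also have "\<dots> \<le> K" using le[of n] t by (simp add: power_divide field_simps)
    finally show False using n by simp
  qed
qed

section \<open>Uniqueness of the C*-norm\<close>

lemma cring_complex_ring: "cring complex_ring"
proof (rule cringI)
  show "abelian_group complex_ring"
    by (rule abelian_groupI) (auto simp: complex_ring_def algebra_simps add_eq_0_iff)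
  show "Group.comm_monoid complex_ring"
    by (rule comm_monoidI) (auto simp: complex_ring_def algebra_simps)
qed (auto simp: complex_ring_def algebra_simps)

text \<open>For an equivalence relation R these block matrices form a *-algebra: the total relation
  gives all of them, equality gives the block diagonal ones.\<close>

definition blocks :: "('j::finite \<Rightarrow> 'j \<Rightarrow> bool) \<Rightarrow> nat \<Rightarrow> ('j \<Rightarrow> 'j \<Rightarrow> fmat) set" where
  "blocks R n = {X. \<forall>j k. supp n (X j k) \<and> (\<not> R j k \<longrightarrow> X j k = 0)}"

text \<open>A *-isomorphism of B onto \<open>blocks R n\<close>. The norm of B is left free, so that
  existence and uniqueness of a C*-norm can both be proved here.\<close>

locale block_model =
  fixes B :: "'b cstar" (structure) and R :: "'j::finite \<Rightarrow> 'j \<Rightarrow> bool" and n :: nat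
    and \<theta> :: "'b \<Rightarrow> 'j \<Rightarrow> 'j \<Rightarrow> fmat"
  assumes equivR: "equivp R"
    and bij: "bij_betw \<theta> (carrier B) (blocks R n)"
    and zero [simp]: "\<zero> \<in> carrier B" "\<theta> \<zero> = (\<lambda>_ _. 0)"
    and add [simp]: "\<And>x y. x \<in> carrier B \<Longrightarrow> y \<in> carrier B \<Longrightarrow> x \<oplus> y \<in> carrier B"
      "\<And>x y. x \<in> carrier B \<Longrightarrow> y \<in> carrier B \<Longrightarrow> \<theta> (x \<oplus> y) = (\<lambda>j k. \<theta> x j k + \<theta> y j k)"
    and smult [simp]: "\<And>c x. x \<in> carrier B \<Longrightarrow> c \<odot> x \<in> carrier B"
      "\<And>c x. x \<in> carrier B \<Longrightarrow> \<theta> (c \<odot> x) = (\<lambda>j k. cs c (\<theta> x j k))"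
    and mult [simp]: "\<And>x y. x \<in> carrier B \<Longrightarrow> y \<in> carrier B \<Longrightarrow> x \<otimes> y \<in> carrier B"
      "\<And>x y. x \<in> carrier B \<Longrightarrow> y \<in> carrier B \<Longrightarrow> \<theta> (x \<otimes> y) = bmult (\<theta> x) (\<theta> y)"
    and star [simp]: "\<And>x. x \<in> carrier B \<Longrightarrow> star B x \<in> carrier B"
      "\<And>x. x \<in> carrier B \<Longrightarrow> \<theta> (star B x) = badj (\<theta> x)"
begin

lemma \<theta>_inj: "x \<in> carrier B \<Longrightarrow> y \<in> carrier B \<Longrightarrow> \<theta> x = \<theta> y \<longleftrightarrow> x = y"
  using bij by (auto simp: bij_betw_def dest: inj_onD)

lemma \<theta>_blocks: "x \<in> carrier B \<Longrightarrow> \<theta> x \<in> blocks R n"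
  using bij by (auto simp: bij_betw_def)

lemma \<theta>_surj:
  assumes "X \<in> blocks R n"
  obtains x where "x \<in> carrier B" "\<theta> x = X"
  using bij assms by (metis bij_betw_def imageE)

lemma uminus_ex:
  assumes "x \<in> carrier B"
  shows "\<exists>y\<in>carrier B. y \<oplus> x = \<zero>"
proof
  show "((-1) \<odot> x) \<in> carrier B" using assms by simp
  show "((-1) \<odot> x) \<oplus> x = \<zero>"
    using assms by (simp add: \<theta>_inj[symmetric] cs_minus)
qed

lemma model_abelian_group: "abelian_group B"
proof (rule abelian_groupI)
  fix x assume "x \<in> carrier B"
  then show "\<exists>y\<in>carrier B. y \<oplus> x = \<zero>" by (rule uminus_ex)
qed (simp_all add: \<theta>_inj[symmetric] ac_simps)

lemma model_module: "module complex_ring B"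
  by (rule moduleI[OF cring_complex_ring model_abelian_group])
     (simp_all add: \<theta>_inj[symmetric] complex_ring_def cs_add fmat_eqI fun_eq_iff distrib_right)

lemma \<theta>_minus [simp]:
  assumes "x \<in> carrier B" "y \<in> carrier B"
  shows "x \<ominus> y \<in> carrier B" "\<theta> (x \<ominus> y) = (\<lambda>j k. \<theta> x j k - \<theta> y j k)"
proof -
  interpret abelian_group B by (rule model_abelian_group)
  show c: "x \<ominus> y \<in> carrier B" using assms by simp
  have "(x \<ominus> y) \<oplus> y = x" using assms by (simp add: a_minus_def a_assoc l_neg)
  then have "\<theta> x = (\<lambda>j k. \<theta> (x \<ominus> y) j k + \<theta> y j k)" using assms c by (metis add(2))
  then show "\<theta> (x \<ominus> y) = (\<lambda>j k. \<theta> x j k - \<theta> y j k)" by simp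
qed

lemma bnorm_entry_sum:
  assumes "X \<in> blocks R n"
  shows "bnorm X \<le> (\<Sum>j\<in>UNIV. \<Sum>k\<in>UNIV. \<Sum>r<n. \<Sum>s<n. cmod (ent (X j k) r s))"
  by (rule order.trans[OF bnorm_le_sum]) (intro sum_mono norm_le_sum_ent, use assms in \<open>auto simp: blocks_def\<close>)

text \<open>A Cauchy sequence converges entrywise, its limit has the same support pattern, and
  \<open>bnorm\<close> is dominated by the finite sum of the moduli of the entries.\<close>

lemma model_complete:
  assumes X: "\<And>m. X m \<in> carrier B"
    and cauchy: "\<forall>e>0. \<exists>N. \<forall>m\<ge>N. \<forall>l\<ge>N. bnorm (\<theta> (X m \<ominus> X l)) < e"
  shows "\<exists>x\<in>carrier B. (\<lambda>m. bnorm (\<theta> (X m \<ominus> x))) \<longlonglongrightarrow> 0"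
proof -
  let ?e = "\<lambda>m j k r s. ent (\<theta> (X m) j k) r s"
  have "convergent (\<lambda>m. ?e m j k r s)" for j k r s
  proof (rule Cauchy_convergent, rule CauchyI)
    fix e :: real assume "e > 0"
    then obtain N where N: "\<And>m l. m \<ge> N \<Longrightarrow> l \<ge> N \<Longrightarrow> bnorm (\<theta> (X m \<ominus> X l)) < e" using cauchy by blast
    have "norm (?e m j k r s - ?e l j k r s) < e" if "m \<ge> N" "l \<ge> N" for m l
      using order.strict_trans1[OF norm_block_le N[OF that]] X by simp
    then show "\<exists>N. \<forall>m\<ge>N. \<forall>l\<ge>N. norm (?e m j k r s - ?e l j k r s) < e" by blast
  qed
  then obtain L where L: "\<And>j k r s. (\<lambda>m. ?e m j k r s) \<longlonglongrightarrow> L j k r s"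
    unfolding convergent_def by metis
  have 0: "L j k r s = 0" if "n \<le> r \<or> n \<le> s \<or> \<not> R j k" for j k r s
  proof -
    have "?e m j k r s = 0" for m
      using \<theta>_blocks[OF X[of m]] that by (auto simp: blocks_def supp_def)
    then show ?thesis using L[of j k r s] by (simp add: LIMSEQ_const_iff)
  qed
  define Y where "Y j k = Fmat (L j k)" for j k
  have entY: "ent (Y j k) = L j k" for j k
    unfolding Y_def by (rule ent_Fmat[of n]) (use 0 in auto)
  have Y: "Y \<in> blocks R n"
    unfolding blocks_def using 0 by (auto simp: supp_def entY intro!: fmat_eqI)
  then obtain x where x: "x \<in> carrier B" "\<theta> x = Y" by (rule \<theta>_surj)
  have "(\<lambda>m. bnorm (\<theta> (X m \<ominus> x))) \<longlonglongrightarrow> 0"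
  proof (rule tendsto_sandwich[OF _ _ tendsto_const])
    let ?f = "\<lambda>m. \<Sum>j\<in>UNIV. \<Sum>k\<in>UNIV. \<Sum>r<n. \<Sum>s<n. cmod (?e m j k r s - L j k r s)"
    have "?f \<longlonglongrightarrow> (\<Sum>j\<in>(UNIV :: 'j set). \<Sum>k\<in>(UNIV :: 'j set). \<Sum>r<n. \<Sum>s<n. cmod (L j k r s - L j k r s))"
      by (intro tendsto_intros L)
    then show "?f \<longlonglongrightarrow> 0" by simp
    have "bnorm (\<theta> (X m \<ominus> x)) \<le> ?f m" for m
      using bnorm_entry_sum[OF \<theta>_blocks[of "X m \<ominus> x"]] X x by (simp add: entY)
    then show "\<forall>\<^sub>F m in sequentially. bnorm (\<theta> (X m \<ominus> x)) \<le> ?f m" by simp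
  qed (auto simp: bnorm_nonneg)
  with x(1) show ?thesis by blast
qed

lemma bmult_assoc: "bmult (bmult X Y) Z = bmult X (bmult Y Z)"
proof -
  have "(\<Sum>k\<in>UNIV. (\<Sum>l\<in>UNIV. X i l * Y l k) * Z k j) = (\<Sum>l\<in>UNIV. X i l * (\<Sum>k\<in>UNIV. Y l k * Z k j))" for i j
    by (simp add: sum_distrib_left sum_distrib_right mult.assoc) (rule sum.swap)
  then show ?thesis by (simp add: bmult_def fun_eq_iff)
qed

text \<open>The axioms are pulled back through \<theta>. This is the existence half for the norm on
  M_n(A).\<close>

lemma model_cstar_algebra:
  assumes nrm: "\<And>x. x \<in> carrier B \<Longrightarrow> nrm B x = bnorm (\<theta> x)"
  shows "cstar_algebra B"
proof -
  have eq0: "bnorm X = 0 \<longleftrightarrow> X = (\<lambda>_ _. 0)" for X :: "'j \<Rightarrow> 'j \<Rightarrow> fmat"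
    using bnorm_eq_0D[of X] by (auto simp: bnorm_0)
  show ?thesis
  proof (rule cstar_algebra.intro[OF model_module], rule cstar_algebra_axioms.intro)
    fix X :: "nat \<Rightarrow> 'b"
    assume X: "\<And>m. X m \<in> carrier B"
      and cauchy: "\<forall>e>0. \<exists>N. \<forall>m\<ge>N. \<forall>l\<ge>N. nrm B (X m \<ominus> X l) < e"
    have "\<forall>e>0. \<exists>N. \<forall>m\<ge>N. \<forall>l\<ge>N. bnorm (\<theta> (X m \<ominus> X l)) < e"
      using cauchy X by (simp add: nrm)
    from model_complete[OF X this] obtain x where "x \<in> carrier B" "(\<lambda>m. bnorm (\<theta> (X m \<ominus> x))) \<longlonglongrightarrow> 0"
      by blast
    then show "\<exists>x\<in>carrier B. (\<lambda>m. nrm B (X m \<ominus> x)) \<longlonglongrightarrow> 0"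
      using X by (auto simp: nrm intro!: bexI[of _ x])
  next
    fix x y assume "x \<in> carrier B" "y \<in> carrier B"
    then show "nrm B (x \<oplus> y) \<le> nrm B x + nrm B y" "nrm B (x \<otimes> y) \<le> nrm B x * nrm B y"
      by (simp_all add: nrm bnorm_triangle bnorm_bmult)
    from \<open>x \<in> carrier B\<close> show "nrm B (star B x \<otimes> x) = (nrm B x)\<^sup>2" "(nrm B x = 0) = (x = \<zero>)"
      by (simp_all add: nrm bnorm_cstar eq0 \<theta>_inj[symmetric])
  next
    fix x y z assume "x \<in> carrier B" "y \<in> carrier B" "z \<in> carrier B"
    then show "x \<otimes> y \<otimes> z = x \<otimes> (y \<otimes> z)"
      by (simp add: \<theta>_inj[symmetric] bmult_assoc)
  qed (simp_all add: nrm \<theta>_inj[symmetric] bnorm_nonneg bnorm_cs, simp_all add: bmult_def badj_def fun_eq_iff distrib_left distrib_right sum.distrib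
        cs_sum cs_mult_left cs_mult_right adj_add adj_cs adj_sum adj_mult)
qed

text \<open>On self-adjoint elements a C*-norm satisfies \<open>\<nu>(a\<^bsup>m\<^esup>) = \<nu>(a)\<^bsup>m\<^esup>\<close> for \<open>m\<close> a power of two, so two
  equivalent C*-norms coincide.\<close>

lemma model_norm_unique:
  assumes C: "cstar_algebra B" and x: "x \<in> carrier B"
  shows "nrm B x = bnorm (\<theta> x)"
proof -
  interpret cstar_algebra B by (rule C)
  define unit where "unit j k r s = (\<lambda>j' k'. if j' = j \<and> k' = k then munit r s else 0)" for j k :: 'j and r s
  \<comment> \<open>Preimages of the matrix units under \<theta>; they serve as a basis of
    B.\<close>
  define e where "e j k r s = (SOME x. x \<in> carrier B \<and> \<theta> x = unit j k r s)" for j k r s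
  have e: "e j k r s \<in> carrier B" "\<theta> (e j k r s) = unit j k r s" if "R j k" "r < n" "s < n" for j k r s
  proof -
    have "unit j k r s \<in> blocks R n" using that by (auto simp: blocks_def unit_def supp_munit intro: supp_simps)
    then have "\<exists>x. x \<in> carrier B \<and> \<theta> x = unit j k r s" using \<theta>_surj by metis
    then have "e j k r s \<in> carrier B \<and> \<theta> (e j k r s) = unit j k r s" unfolding e_def by (rule someI_ex)
    then show "e j k r s \<in> carrier B" "\<theta> (e j k r s) = unit j k r s" by auto
  qed
  have Rr: "R j j" for j using equivR by (simp add: equivp_reflp)
  have nz: "0 < nrm B (e j k r s)" if "R j k" "r < n" "s < n" for j k r s
  proof -
    have "unit j k r s \<noteq> (\<lambda>_ _. 0)"
    proof
      assume "unit j k r s = (\<lambda>_ _. 0)"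
      then have "ent (unit j k r s j k) r s = 0" by simp
      then show False by (simp add: unit_def)
    qed
    then have "e j k r s \<noteq> \<zero>" using e(2)[OF that] by auto
    then show ?thesis using nrm_eq_zero[OF e(1)[OF that]] nrm_nonneg[OF e(1)[OF that]] by simp
  qed
  define \<Omega> where "\<Omega> = {(j, k, r, s). R j k \<and> r < n \<and> s < n}"
  have fin: "finite \<Omega>"
    by (rule finite_subset[of _ "UNIV \<times> UNIV \<times> {..<n} \<times> {..<n}"]) (auto simp: \<Omega>_def)
  define entry where "entry x = (\<lambda>(j, k, r, s). ent (\<theta> x j k) r s)" for x
  define E where "E = (\<lambda>(j, k, r, s). e j k r s)"
  \<comment> \<open>Expansion of y in this basis, split off one matrix unit at a time; the induction
    is on a set F containing the support.\<close>
  have upper: "nrm B y \<le> (\<Sum>t\<in>F. cmod (entry y t) * nrm B (E t))"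
    if "finite F" "F \<subseteq> \<Omega>" "y \<in> carrier B" "\<And>t. t \<notin> F \<Longrightarrow> entry y t = 0" for F y
    using that
  proof (induction F arbitrary: y rule: finite_induct)
    case empty
    have "\<theta> y = (\<lambda>_ _. 0)"
      using empty(3) by (intro ext fmat_eqI) (auto simp: entry_def)
    then have "y = \<zero>" using empty(2) by (simp add: \<theta>_inj[symmetric])
    then show ?case using nrm_eq_zero[of \<zero>] by simp
  next
    case (insert t F)
    obtain j k r s where t: "t = (j, k, r, s)" by (cases t)
    have t\<Omega>: "R j k" "r < n" "s < n" using insert(4) by (auto simp: t \<Omega>_def)
    note et = e[OF t\<Omega>]
    define z where "z = y \<oplus> ((- entry y t) \<odot> e j k r s)"
    have z: "z \<in> carrier B" using insert.prems et by (simp add: z_def)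
    have entz: "entry z t' = (if t' = t then 0 else entry y t')" for t'
      using insert.prems(2) et by (cases t') (auto simp: z_def entry_def unit_def t)
    have y: "y = z \<oplus> (entry y t \<odot> e j k r s)"
      using insert.prems(2) et z by (simp add: \<theta>_inj[symmetric]) (simp add: z_def et insert.prems cs_minus)
    have "nrm B z \<le> (\<Sum>t\<in>F. cmod (entry z t) * nrm B (E t))"
      using insert.prems insert.hyps by (intro insert.IH z) (auto simp: entz)
    also have "\<dots> = (\<Sum>t\<in>F. cmod (entry y t) * nrm B (E t))"
      using insert.hyps by (intro sum.cong) (auto simp: entz)
    finally have "nrm B z \<le> (\<Sum>t\<in>F. cmod (entry y t) * nrm B (E t))" .
    moreover have "nrm B y \<le> nrm B z + cmod (entry y t) * nrm B (E t)"
      by (subst y) (use nrm_triangle[of z "entry y t \<odot> e j k r s"] z et nrm_smult[OF et(1)] in \<open>simp add: E_def t\<close>)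
    ultimately show ?case using insert.hyps by simp
  qed
  define K where "K = (\<Sum>t\<in>\<Omega>. nrm B (E t))"
  have up: "nrm B y \<le> K * bnorm (\<theta> y)" if y: "y \<in> carrier B" for y
  proof -
    have "nrm B y \<le> (\<Sum>t\<in>\<Omega>. cmod (entry y t) * nrm B (E t))"
    proof (intro upper fin y order.refl)
      fix t assume "t \<notin> \<Omega>"
      moreover obtain j k r s where "t = (j, k, r, s)" by (cases t)
      moreover have "supp n (\<theta> y j k)" "\<not> R j k \<Longrightarrow> \<theta> y j k = 0"
        using \<theta>_blocks[OF y] by (auto simp: blocks_def)
      ultimately show "entry y t = 0"
        by (cases "R j k") (auto simp: \<Omega>_def entry_def supp_def not_less)
    qed
    also have "\<dots> \<le> (\<Sum>t\<in>\<Omega>. bnorm (\<theta> y) * nrm B (E t))"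
      using e(1) by (intro sum_mono mult_right_mono) (auto simp: entry_def norm_block_le E_def \<Omega>_def nrm_nonneg)
    finally show ?thesis by (simp add: K_def sum_distrib_left mult.commute)
  qed
  \<comment> \<open>Compressing y between two diagonal matrix units isolates one entry: e_jjrr y
    e_kkss is that entry times e_jkrs. Submultiplicativity then bounds the entry by a constant times
    the norm of y, and L is the sum of these constants.\<close>
  define L where "L = (\<Sum>j\<in>UNIV. \<Sum>k\<in>UNIV. \<Sum>r<n. \<Sum>s<n.
     if R j k then nrm B (e j j r r) * nrm B (e k k s s) / nrm B (e j k r s) else 0)"
  have lo: "bnorm (\<theta> y) \<le> L * nrm B y" if y: "y \<in> carrier B" for y
  proof -
    have "cmod (ent (\<theta> y j k) r s)
       \<le> (if R j k then nrm B (e j j r r) * nrm B (e k k s s) / nrm B (e j k r s) else 0) * nrm B y"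
      if rs: "r < n" "s < n" for j k r s
    proof (cases "R j k")
      case True
      note ee = e[OF True rs] e[OF Rr rs(1) rs(1), of j] e[OF Rr rs(2) rs(2), of k]
      have sy: "supp n (\<theta> y j k)" for j k using \<theta>_blocks[OF y] by (simp add: blocks_def)
      have "bmult (unit j j r r) (bmult (\<theta> y) (unit k k s s)) = (\<lambda>j' k'. cs (ent (\<theta> y j k) r s) (unit j k r s j' k'))"
      proof (intro ext fmat_eqI)
        fix j' k' r' s'
        have m: "munit r r * (\<theta> y j k * munit s s) = cs (ent (\<theta> y j k) r s) (munit r s)"
          by (rule fmat_eqI) (simp add: ent_mult[OF supp_munit[OF rs(1) rs(1)]] ent_mult[OF sy] if_distrib if_distribR rs cong: if_cong)
        have "bmult (\<theta> y) (unit k k s s) j k' = (if k' = k then \<theta> y j k * munit s s else 0)" for j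
          by (simp add: bmult_def unit_def if_distrib cong: if_cong)
        then have "bmult (unit j j r r) (bmult (\<theta> y) (unit k k s s)) j' k'
          = (if j' = j \<and> k' = k then munit r r * (\<theta> y j k * munit s s) else 0)"
          by (simp add: bmult_def[of "unit j j r r"]) (simp add: unit_def if_distrib if_distribR cong: if_cong)
        then show "ent (bmult (unit j j r r) (bmult (\<theta> y) (unit k k s s)) j' k') r' s' = ent (cs (ent (\<theta> y j k) r s) (unit j k r s j' k')) r' s'"
          by (simp add: m unit_def)
      qed
      then have "e j j r r \<otimes> (y \<otimes> e k k s s) = ent (\<theta> y j k) r s \<odot> e j k r s"
        using ee y by (simp add: \<theta>_inj[symmetric])
      then have "cmod (ent (\<theta> y j k) r s) * nrm B (e j k r s) = nrm B (e j j r r \<otimes> (y \<otimes> e k k s s))"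
        using nrm_smult[OF ee(1)] by simp
      also have "\<dots> \<le> nrm B (e j j r r) * (nrm B y * nrm B (e k k s s))"
        using ee y by (intro order.trans[OF nrm_mult] mult_left_mono nrm_mult nrm_nonneg) auto
      finally show ?thesis using nz[OF True rs] True by (simp add: field_simps)
    next
      case False
      then show ?thesis using \<theta>_blocks[OF y] by (simp add: blocks_def)
    qed
    then have "(\<Sum>j\<in>UNIV. \<Sum>k\<in>UNIV. \<Sum>r<n. \<Sum>s<n. cmod (ent (\<theta> y j k) r s)) \<le> L * nrm B y"
      unfolding L_def sum_distrib_right by (intro sum_mono) simp
    then show ?thesis using bnorm_entry_sum[OF \<theta>_blocks[OF y]] by linarith
  qed
  have selfadj: "nrm B a = bnorm (\<theta> a)" if a: "a \<in> carrier B" "star B a = a" for a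
  proof -
    \<comment> \<open>Repeated squaring: \<open>sq m\<close> is a to the power 2^m. It stays
      self-adjoint, so both norms of it are the corresponding powers by the C*-identity.\<close>
    define sq where "sq m = ((\<lambda>b. b \<otimes> b) ^^ m) a" for m
    have sq_Suc: "sq (Suc m) = sq m \<otimes> sq m" for m by (simp add: sq_def)
    have sq_0: "sq 0 = a" by (simp add: sq_def)
    have sq: "sq m \<in> carrier B \<and> star B (sq m) = sq m" for m
      by (induction m) (use a in \<open>auto simp: sq_0 sq_Suc star_mult\<close>)
    have p1: "nrm B (sq m) = nrm B a ^ (2 ^ m)" for m
    proof (induction m)
      case (Suc m)
      then show ?case using cstar_identity[of "sq m"] sq[of m] by (simp add: sq_Suc power_mult[symmetric] mult.commute)
    qed (simp add: sq_def)
    have p2: "bnorm (\<theta> (sq m)) = bnorm (\<theta> a) ^ (2 ^ m)" for m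
    proof (induction m)
      case (Suc m)
      have "badj (\<theta> (sq m)) = \<theta> (sq m)" using sq[of m] by (metis star(2))
      then show ?case using Suc bnorm_cstar[of "\<theta> (sq m)"] sq[of m] by (simp add: sq_Suc power_mult[symmetric] mult.commute)
    qed (simp add: sq_def)
    show ?thesis
    proof (rule order.antisym)
      show "nrm B a \<le> bnorm (\<theta> a)"
        by (rule le_of_pow2_le[of _ _ K]) (use up[of "sq _"] sq a p1 p2 in \<open>auto simp: nrm_nonneg bnorm_nonneg\<close>)
      show "bnorm (\<theta> a) \<le> nrm B a"
        by (rule le_of_pow2_le[of _ _ L]) (use lo[of "sq _"] sq a p1 p2 in \<open>auto simp: nrm_nonneg bnorm_nonneg\<close>)
    qed
  qed
  \<comment> \<open>The general case follows from the self-adjoint element x^* x and the C*-identity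
    of both norms.\<close>
  have "(nrm B x)\<^sup>2 = nrm B (star B x \<otimes> x)" using cstar_identity[OF x] by simp
  also have "\<dots> = bnorm (\<theta> (star B x \<otimes> x))"
    using x by (intro selfadj) (auto simp: star_mult star_star)
  also have "\<dots> = (bnorm (\<theta> x))\<^sup>2" using x by (simp add: bnorm_cstar)
  finally show ?thesis using nrm_nonneg[OF x] bnorm_nonneg[of "\<theta> x"] by simp
qed

end

section \<open>Matrices over subalgebras of a matrix algebra\<close>

definition fmat_of :: "nat \<Rightarrow> (nat \<Rightarrow> nat \<Rightarrow> complex) \<Rightarrow> fmat" where
  "fmat_of n f = Fmat (\<lambda>r s. if r < n \<and> s < n then f r s else 0)"

lemma ent_fmat_of [simp]: "ent (fmat_of n f) r s = (if r < n \<and> s < n then f r s else 0)"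
  unfolding fmat_of_def by (subst ent_Fmat[of n]) auto

lemma supp_fmat_of: "supp n (fmat_of n f)"
  by (auto simp: supp_def)

lemma fmat_of_mult: "fmat_of n f * fmat_of n g = fmat_of n (\<lambda>r s. \<Sum>k<n. f r k * g k s)"
  by (rule fmat_eqI) (auto simp: ent_mult[OF supp_fmat_of])

text \<open>A *-isomorphism of A onto the scalar matrices supported on R. No norm occurs, since the
  norms on M_n(A) are determined by the *-algebra structure.\<close>

locale scalar_model =
  fixes A :: "'a cstar" (structure) and R :: "'j::finite \<Rightarrow> 'j \<Rightarrow> bool"
    and \<rho> :: "'a \<Rightarrow> 'j \<Rightarrow> 'j \<Rightarrow> complex"
  assumes equivR: "equivp R"
    and bij: "bij_betw \<rho> (carrier A) {m. \<forall>j k. \<not> R j k \<longrightarrow> m j k = 0}"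
    and zero [simp]: "\<zero> \<in> carrier A" "\<rho> \<zero> = (\<lambda>_ _. 0)"
    and add [simp]: "\<And>x y. x \<in> carrier A \<Longrightarrow> y \<in> carrier A \<Longrightarrow> x \<oplus> y \<in> carrier A"
      "\<And>x y. x \<in> carrier A \<Longrightarrow> y \<in> carrier A \<Longrightarrow> \<rho> (x \<oplus> y) = (\<lambda>j k. \<rho> x j k + \<rho> y j k)"
    and smult [simp]: "\<And>c x. x \<in> carrier A \<Longrightarrow> c \<odot> x \<in> carrier A"
      "\<And>c x. x \<in> carrier A \<Longrightarrow> \<rho> (c \<odot> x) = (\<lambda>j k. c * \<rho> x j k)"
    and mult [simp]: "\<And>x y. x \<in> carrier A \<Longrightarrow> y \<in> carrier A \<Longrightarrow> x \<otimes> y \<in> carrier A"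
      "\<And>x y. x \<in> carrier A \<Longrightarrow> y \<in> carrier A \<Longrightarrow> \<rho> (x \<otimes> y) = (\<lambda>j l. \<Sum>k\<in>UNIV. \<rho> x j k * \<rho> y k l)"
    and star [simp]: "\<And>x. x \<in> carrier A \<Longrightarrow> star A x \<in> carrier A"
      "\<And>x. x \<in> carrier A \<Longrightarrow> \<rho> (star A x) = (\<lambda>j k. cnj (\<rho> x k j))"
begin

lemma \<rho>_inj: "x \<in> carrier A \<Longrightarrow> y \<in> carrier A \<Longrightarrow> \<rho> x = \<rho> y \<longleftrightarrow> x = y"
  using bij by (auto simp: bij_betw_def dest: inj_onD)

lemma \<rho>_off: "x \<in> carrier A \<Longrightarrow> \<not> R j k \<Longrightarrow> \<rho> x j k = 0"
  using bij by (auto simp: bij_betw_def)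

lemma \<rho>_surj: "(\<And>j k. \<not> R j k \<Longrightarrow> m j k = 0) \<Longrightarrow> \<exists>x\<in>carrier A. \<rho> x = m"
proof -
  assume "\<And>j k. \<not> R j k \<Longrightarrow> m j k = 0"
  then have "m \<in> \<rho> ` carrier A" using bij by (simp add: bij_betw_def)
  then show ?thesis by auto
qed

lemma zero_zero [simp]: "\<zero> \<oplus> \<zero> = \<zero>" "c \<odot> \<zero> = \<zero>"
  by (simp_all add: \<rho>_inj[symmetric])

section \<open>Embedding A and the algebras M_n(A) into block matrices\<close>

definition lift1 :: "'a \<Rightarrow> 'j \<Rightarrow> 'j \<Rightarrow> fmat" where
  "lift1 x j k = fmat_of 1 (\<lambda>_ _. \<rho> x j k)"

text \<open>With blocks of size 1, A itself becomes a block model; this supplies its additive group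
  structure for the finite sums in matrix products.\<close>

lemma block_model_lift1: "block_model A R 1 lift1"
proof
  show "bij_betw lift1 (carrier A) (blocks R 1)"
  proof (rule bij_betw_imageI)
    show "inj_on lift1 (carrier A)"
    proof (rule inj_onI)
      fix x y assume xy: "x \<in> carrier A" "y \<in> carrier A" "lift1 x = lift1 y"
      have "\<rho> x j k = \<rho> y j k" for j k
        using arg_cong[OF xy(3), of "\<lambda>X. ent (X j k) 0 0"] by (simp add: lift1_def)
      then show "x = y" using \<rho>_inj[OF xy(1,2)] by blast
    qed
    have "lift1 x \<in> blocks R 1" if "x \<in> carrier A" for x
      unfolding blocks_def lift1_def
      using that by (auto simp: supp_fmat_of[of 1, simplified] \<rho>_off intro!: fmat_eqI)
    moreover have "X \<in> lift1 ` carrier A" if X: "X \<in> blocks R 1" for X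
    proof -
      have *: "supp 1 (X j k)" "\<not> R j k \<Longrightarrow> X j k = 0" for j k using X by (auto simp: blocks_def)
      then obtain x where x: "x \<in> carrier A" "\<rho> x = (\<lambda>j k. ent (X j k) 0 0)"
        using \<rho>_surj[of "\<lambda>j k. ent (X j k) 0 0"] by auto
      have "X = lift1 x"
        by (intro ext supp_eqI[OF *(1)]) (auto simp: lift1_def x supp_fmat_of[of 1, simplified])
      with x(1) show ?thesis by blast
    qed
    ultimately show "lift1 ` carrier A = blocks R 1" by blast
  qed
  fix x y assume xy: "x \<in> carrier A" "y \<in> carrier A"
  show "lift1 (x \<otimes> y) = bmult (lift1 x) (lift1 y)"
    using xy by (intro ext fmat_eqI) (auto simp: lift1_def bmult_def fmat_of_mult[of 1, simplified])
qed (auto simp: equivR lift1_def badj_def intro!: ext fmat_eqI)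

lemma abelian_monoid_A: "abelian_monoid A"
  using block_model.model_abelian_group[OF block_model_lift1] by (rule abelian_group.axioms)

lemma \<rho>_finsum:
  assumes "finite F" "\<And>x. x \<in> F \<Longrightarrow> g x \<in> carrier A"
  shows "finsum A g F \<in> carrier A" "\<rho> (finsum A g F) = (\<lambda>j k. \<Sum>x\<in>F. \<rho> (g x) j k)"
proof -
  interpret abelian_monoid A by (rule abelian_monoid_A)
  have "finsum A g F \<in> carrier A \<and> \<rho> (finsum A g F) = (\<lambda>j k. \<Sum>x\<in>F. \<rho> (g x) j k)"
    using assms by (induction F) (auto simp: finsum_insert)
  then show "finsum A g F \<in> carrier A" "\<rho> (finsum A g F) = (\<lambda>j k. \<Sum>x\<in>F. \<rho> (g x) j k)" by auto
qed

text \<open>The canonical shuffle, which regards an n x n matrix over N x N matrices as an N x N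
  matrix of n x n blocks.\<close>

definition lift :: "nat \<Rightarrow> (nat \<Rightarrow> nat \<Rightarrow> 'a) \<Rightarrow> 'j \<Rightarrow> 'j \<Rightarrow> fmat" where
  "lift n x j k = fmat_of n (\<lambda>r s. \<rho> (x r s) j k)"

lemma block_model_lift: "block_model (mat_alg A n \<nu>) R n (lift n)"
proof
  show "bij_betw (lift n) (carrier (mat_alg A n \<nu>)) (blocks R n)"
  proof (rule bij_betw_imageI)
    show "inj_on (lift n) (carrier (mat_alg A n \<nu>))"
    proof (rule inj_onI)
      fix x y assume x: "x \<in> carrier (mat_alg A n \<nu>)" and y: "y \<in> carrier (mat_alg A n \<nu>)"
        and xy: "lift n x = lift n y"
      show "x = y"
      proof (intro ext)
        fix r s
        show "x r s = y r s"
        proof (cases "r < n \<and> s < n")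
          case True
          have "\<rho> (x r s) j k = \<rho> (y r s) j k" for j k
            using arg_cong[OF xy, of "\<lambda>X. ent (X j k) r s"] True by (simp add: lift_def)
          then have "\<rho> (x r s) = \<rho> (y r s)" by blast
          then show ?thesis using x y True \<rho>_inj by (simp add: mat_alg_def)
        next
          case False
          then show ?thesis using x y by (auto simp: mat_alg_def)
        qed
      qed
    qed
    have "lift n x \<in> blocks R n" if "x \<in> carrier (mat_alg A n \<nu>)" for x
      unfolding blocks_def lift_def
      using that by (auto simp: supp_fmat_of mat_alg_def \<rho>_off intro!: fmat_eqI)
    moreover have "X \<in> lift n ` carrier (mat_alg A n \<nu>)" if X: "X \<in> blocks R n" for X
    proof -
      have *: "supp n (X j k)" "\<not> R j k \<Longrightarrow> X j k = 0" for j k using X by (auto simp: blocks_def)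
      have "\<exists>x\<in>carrier A. \<rho> x = (\<lambda>j k. ent (X j k) r s)" for r s
        by (rule \<rho>_surj) (simp add: *)
      then obtain g where g: "\<And>r s. g r s \<in> carrier A" "\<And>r s. \<rho> (g r s) = (\<lambda>j k. ent (X j k) r s)" by metis
      define x where "x r s = (if r < n \<and> s < n then g r s else \<zero>)" for r s
      have "X = lift n x"
        by (intro ext supp_eqI[OF *(1)]) (auto simp: lift_def x_def g supp_fmat_of)
      moreover have "x \<in> carrier (mat_alg A n \<nu>)" by (auto simp: mat_alg_def x_def g)
      ultimately show ?thesis by blast
    qed
    ultimately show "lift n ` carrier (mat_alg A n \<nu>) = blocks R n" by blast
  qed
  fix x y assume xy: "x \<in> carrier (mat_alg A n \<nu>)" "y \<in> carrier (mat_alg A n \<nu>)"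
  then have c: "r < n \<Longrightarrow> s < n \<Longrightarrow> x r s \<in> carrier A" "r < n \<Longrightarrow> s < n \<Longrightarrow> y r s \<in> carrier A" for r s
    by (auto simp: mat_alg_def)
  have fs: "finsum A (\<lambda>k. x r k \<otimes> y k s) {..<n} \<in> carrier A"
    "\<rho> (finsum A (\<lambda>k. x r k \<otimes> y k s) {..<n}) = (\<lambda>j k. \<Sum>t<n. \<rho> (x r t \<otimes> y t s) j k)"
    if "r < n" "s < n" for r s
  proof -
    have *: "x r k \<otimes> y k s \<in> carrier A" if "k \<in> {..<n}" for k
      using that \<open>r < n\<close> \<open>s < n\<close> by (simp add: c)
    show "finsum A (\<lambda>k. x r k \<otimes> y k s) {..<n} \<in> carrier A"
      "\<rho> (finsum A (\<lambda>k. x r k \<otimes> y k s) {..<n}) = (\<lambda>j k. \<Sum>t<n. \<rho> (x r t \<otimes> y t s) j k)"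
      by (rule \<rho>_finsum[OF finite_lessThan *], assumption)+
  qed
  show "x \<otimes>\<^bsub>mat_alg A n \<nu>\<^esub> y \<in> carrier (mat_alg A n \<nu>)"
    by (auto simp: mat_alg_def fs)
  show "lift n (x \<otimes>\<^bsub>mat_alg A n \<nu>\<^esub> y) = bmult (lift n x) (lift n y)"
  proof (intro ext fmat_eqI)
    fix j l r s
    have "(\<Sum>t<n. \<Sum>k\<in>UNIV. \<rho> (x r t) j k * \<rho> (y t s) k l) = (\<Sum>k\<in>UNIV. \<Sum>t<n. \<rho> (x r t) j k * \<rho> (y t s) k l)"
      by (rule sum.swap)
    then show "ent (lift n (x \<otimes>\<^bsub>mat_alg A n \<nu>\<^esub> y) j l) r s = ent (bmult (lift n x) (lift n y) j l) r s"
      by (cases "r < n \<and> s < n") (auto simp: lift_def bmult_def fmat_of_mult mat_alg_def fs c)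
  qed
qed (auto simp: equivR lift_def badj_def mat_alg_def intro!: ext fmat_eqI)

text \<open>The definite description is evaluated by exhibiting a C*-norm and by the uniqueness of
  its values.\<close>

lemma mat_norm_eq:
  assumes "x \<in> mat_carrier A n"
  shows "mat_norm A n x = bnorm (lift n x)"
  unfolding mat_norm_def
proof (rule the_equality)
  let ?\<nu> = "\<lambda>x. bnorm (lift n x)"
  have "cstar_algebra (mat_alg A n ?\<nu>)"
    by (rule block_model.model_cstar_algebra[OF block_model_lift]) (simp add: mat_alg_def)
  then show "\<exists>\<nu>. cstar_algebra (mat_alg A n \<nu>) \<and> \<nu> x = bnorm (lift n x)" by blast
  fix r assume "\<exists>\<nu>. cstar_algebra (mat_alg A n \<nu>) \<and> \<nu> x = r"
  then obtain \<nu> where \<nu>: "cstar_algebra (mat_alg A n \<nu>)" "\<nu> x = r" by blast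
  have "x \<in> carrier (mat_alg A n \<nu>)" using assms by (simp add: mat_carrier_def mat_alg_def)
  from block_model.model_norm_unique[OF block_model_lift \<nu>(1) this]
  show "r = bnorm (lift n x)" using \<nu>(2) by (simp add: mat_alg_def)
qed

end

section \<open>The completely bounded norm and the constant C(T)\<close>

text \<open>The conditions \<open>kappa\<close> say that \<Sum> a_i a_i^* and \<Sum> a_i^* a_i both
  equal \<kappa> times the identity, and \<open>kappa_card\<close> compares the traces. The element
  in \<open>unit\<close> is the identity matrix, at which states will be bounded by 1.\<close>

locale OH_model = scalar_model A R \<rho> + rigid_family I a lam p q
  for A :: "'a cstar" (structure) and R :: "'j::finite \<Rightarrow> 'j \<Rightarrow> bool" and \<rho>
    and I :: "'i set" and a :: "'i \<Rightarrow> 'j \<Rightarrow> 'j \<Rightarrow> complex" and lam p q +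
  fixes \<kappa> :: real
  assumes a_off: "\<And>i j k. i \<in> I \<Longrightarrow> \<not> R j k \<Longrightarrow> a i j k = 0"
    and kappa: "\<And>j l. (\<Sum>i\<in>I. \<Sum>k\<in>UNIV. a i j k * cnj (a i l k)) = (if j = l then of_real \<kappa> else 0)"
      "\<And>j l. (\<Sum>i\<in>I. \<Sum>k\<in>UNIV. cnj (a i k j) * a i k l) = (if j = l then of_real \<kappa> else 0)"
    and kappa_card: "\<kappa> * real CARD('j) = lam * real (card I)"
    and unit: "\<exists>e\<in>carrier A. \<rho> e = (\<lambda>j k. if j = k then 1 else 0) \<and> nrm A e \<le> 1"
begin

definition T :: "'a \<Rightarrow> 'i \<Rightarrow> complex" where
  "T x i = (if i \<in> I then \<Sum>j\<in>UNIV. \<Sum>k\<in>UNIV. cnj (a i j k) * \<rho> x j k else 0)"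

lemma T_linear: "linear_to_OH A I T"
  unfolding linear_to_OH_def ell2_def
  using finI
  by (auto simp: T_def distrib_left sum.distrib sum_distrib_left mult.left_commute fun_eq_iff)

lemma ent_pairing_lift:
  assumes "i \<in> I" "r < n" "s < n"
  shows "ent (pairing (lift n x) i) r s = T (x r s) i"
  using assms by (simp add: pairing_def lift_def T_def)

lemma supp_pairing_lift: "supp n (pairing (lift n x) i)"
  unfolding pairing_def lift_def by (intro supp_simps supp_fmat_of)

text \<open>Reading vectors indexed by pairs as n x n matrices turns the operator \<Sum> Y_i
  \<otimes> conj Y_i into \<open>cp_map\<close>, whose gap K is the same for all n. The square root
  in \<open>OH_norm\<close> gives sqrt K.\<close>

lemma cb_norm_bound: "\<exists>K. 0 \<le> K \<and> K < lam * real CARD('j) \<and> cb_norm A I T \<le> ereal (sqrt K)"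
proof -
  obtain K where K: "0 \<le> K" "K < lam * real CARD('j)"
    and gap: "\<And>X \<xi>. contr X \<Longrightarrow> norm (cp_map X \<xi>) \<le> K * norm \<xi>"
    using cp_map_gap by blast
  have "OH_norm I n (\<lambda>k l. T (x k l)) \<le> sqrt K" if x: "x \<in> mat_carrier A n" "mat_norm A n x \<le> 1" for n x
  proof -
    let ?J = "{..<n} \<times> {..<n}"
    let ?K = "\<lambda>(k, k') (l, l'). \<Sum>\<^sub>\<infinity>i\<in>I. T (x k l) i * cnj (T (x k' l') i)"
    define X where "X = lift n x"
    have X: "contr X" unfolding X_def using x by (intro contr_bnorm) (simp add: mat_norm_eq)
    have "kernel_opnorm ?J ?K \<le> K"
      unfolding kernel_opnorm_def
    proof (rule cSUP_least)
      have ne: "u \<in> S \<Longrightarrow> S \<noteq> {}" for u :: "nat \<times> nat \<Rightarrow> complex" and S by blast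
      have "(\<lambda>_. 0) \<in> {v :: nat \<times> nat \<Rightarrow> complex. L2_set (\<lambda>k. cmod (v k)) ?J \<le> 1}" by (simp add: L2_set_def)
      then show "{v. L2_set (\<lambda>k. cmod (v k)) ?J \<le> 1} \<noteq> {}"
        by (rule ne)
      fix v :: "nat \<times> nat \<Rightarrow> complex"
      assume v: "v \<in> {v. L2_set (\<lambda>k. cmod (v k)) ?J \<le> 1}"
      \<comment> \<open>The vector v as a matrix, with its Euclidean norm becoming the
        Hilbert-Schmidt norm.\<close>
      define V where "V = fmat_of n (\<lambda>r s. v (r, s))"
      have sV: "supp n V" unfolding V_def by (rule supp_fmat_of)
      have nV: "norm V = L2_set (\<lambda>k. cmod (v k)) ?J"
        unfolding norm_fmat_L2[OF sV] by (rule L2_set_cong) (auto simp: V_def)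
      have sY: "supp n (pairing X i)" "supp n (pairing X i * V)" for i
        using supp_pairing_lift sV by (auto simp: X_def)
      have eY: "ent (pairing X i) r s = T (x r s) i" if "i \<in> I" "r < n" "s < n" for i r s
        unfolding X_def by (rule ent_pairing_lift[OF that])
      have "supp n (cp_map X V)" unfolding cp_map_def by (intro supp_simps supp_mult sY)
      then have "norm (cp_map X V) = L2_set (\<lambda>(k, k'). cmod (ent (cp_map X V) k k')) ?J"
        by (rule norm_fmat_L2)
      also have "\<dots> = L2_set (\<lambda>j. cmod (\<Sum>k\<in>?J. ?K j k * v k)) ?J"
      proof (rule L2_set_cong[OF refl], clarsimp)
        fix k k' assume k: "k < n" "k' < n"
        have "ent (cp_map X V) k k' = (\<Sum>i\<in>I. \<Sum>l'<n. \<Sum>l<n. T (x k l) i * v (l, l') * cnj (T (x k' l') i))"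
          unfolding cp_map_def
          by (simp add: ent_mult[OF sY(2)[unfolded V_def]] ent_mult[OF sY(1)] sum_distrib_right V_def eY k)
        also have "\<dots> = (\<Sum>l'<n. \<Sum>l<n. \<Sum>i\<in>I. T (x k l) i * v (l, l') * cnj (T (x k' l') i))"
          by (subst sum.swap, rule sum.cong[OF refl], rule sum.swap)
        also have "\<dots> = (\<Sum>l<n. \<Sum>l'<n. \<Sum>i\<in>I. T (x k l) i * v (l, l') * cnj (T (x k' l') i))"
          by (rule sum.swap)
        also have "\<dots> = (\<Sum>y\<in>?J. (case y of (l, l') \<Rightarrow> \<Sum>\<^sub>\<infinity>i\<in>I. T (x k l) i * cnj (T (x k' l') i)) * v y)"
        proof -
          have "(\<Sum>i\<in>I. T (x k l) i * v (l, l') * cnj (T (x k' l') i))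
            = (\<Sum>\<^sub>\<infinity>i\<in>I. T (x k l) i * cnj (T (x k' l') i)) * v (l, l')" for l l'
            using finI by (simp add: sum_distrib_right) (simp only: ac_simps)
          then show ?thesis by (simp only: sum.cartesian_product) (simp add: case_prod_unfold)
        qed
        finally show "cmod (ent (cp_map X V) k k') =
          cmod (\<Sum>y\<in>?J. (case y of (l, l') \<Rightarrow> \<Sum>\<^sub>\<infinity>i\<in>I. T (x k l) i * cnj (T (x k' l') i)) * v y)"
          by simp
      qed
      finally have "L2_set (\<lambda>j. cmod (\<Sum>k\<in>?J. ?K j k * v k)) ?J \<le> K * norm V"
        using gap[OF X, of V] by simp
      also have "\<dots> \<le> K" using v K(1) nV by (simp add: mult_left_le)
      finally show "L2_set (\<lambda>j. cmod (\<Sum>k\<in>?J. ?K j k * v k)) ?J \<le> K" .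
    qed
    then show ?thesis unfolding OH_norm_def by (rule real_sqrt_le_mono)
  qed
  then have "cb_norm A I T \<le> ereal (sqrt K)"
    unfolding cb_norm_def by (intro SUP_least) auto
  with K show ?thesis by blast
qed

section \<open>States and the lower bound for C(T)\<close>

lemma state_sum:
  assumes f: "is_state A f" and "finite F" and "\<And>i. i \<in> F \<Longrightarrow> g i \<in> carrier A"
    and "y \<in> carrier A" and "\<rho> y = (\<lambda>j k. \<Sum>i\<in>F. \<rho> (g i) j k)"
  shows "f y = (\<Sum>i\<in>F. f (g i))"
  using assms(2-)
proof (induction F arbitrary: y rule: finite_induct)
  case empty
  then have "y = \<zero>" by (simp add: \<rho>_inj[symmetric])
  then have "f y = 0 * f y" using f empty(2) zero_zero(2)[of 0] unfolding is_state_def by metis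
  then show ?case by simp
next
  case (insert i F)
  \<comment> \<open>The partial sum has to be an element of A; it is, since the support pattern is
    preserved by sums.\<close>
  have "\<exists>z\<in>carrier A. \<rho> z = (\<lambda>j k. \<Sum>i\<in>F. \<rho> (g i) j k)"
    by (rule \<rho>_surj) (simp add: \<rho>_off insert.prems(1))
  then obtain z where z: "z \<in> carrier A" "\<rho> z = (\<lambda>j k. \<Sum>i\<in>F. \<rho> (g i) j k)" by blast
  then have "y = g i \<oplus> z" using insert.prems insert.hyps by (simp add: \<rho>_inj[symmetric])
  moreover have "f z = (\<Sum>i\<in>F. f (g i))" using insert.prems by (intro insert.IH z) auto
  ultimately show ?case using f z(1) insert.prems(1) insert.hyps unfolding is_state_def by simp
qed

text \<open>The b_i sum to \<kappa> e with e in the unit ball, so f(e) has real part at most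
  1.\<close>

lemma state_kappa:
  assumes f: "is_state A f" and b: "\<And>i. i \<in> I \<Longrightarrow> b i \<in> carrier A"
    and sum: "\<And>j k. (\<Sum>i\<in>I. \<rho> (b i) j k) = (if j = k then of_real \<kappa> else 0)"
  shows "(\<Sum>i\<in>I. Re (f (b i))) \<le> \<kappa>"
proof -
  obtain e where e: "e \<in> carrier A" "\<rho> e = (\<lambda>j k. if j = k then 1 else 0)" "nrm A e \<le> 1" using unit by blast
  have k0: "\<kappa> \<ge> 0"
  proof -
    have "\<kappa> = lam * real (card I) / real CARD('j)" using kappa_card by (simp add: field_simps)
    then show ?thesis using lam_pos by simp
  qed
  have "f (of_real \<kappa> \<odot> e) = (\<Sum>i\<in>I. f (b i))"
    by (rule state_sum[OF f finI b]) (auto simp: e sum intro!: ext)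
  then have "(\<Sum>i\<in>I. f (b i)) = of_real \<kappa> * f e" using f e(1) unfolding is_state_def by metis
  then have "(\<Sum>i\<in>I. Re (f (b i))) = \<kappa> * Re (f e)" by (simp flip: Re_sum)
  moreover have "ereal (cmod (f e)) \<le> (SUP x\<in>{x \<in> carrier A. nrm A x \<le> 1}. ereal (cmod (f x)))"
    by (rule SUP_upper) (use e in auto)
  then have "cmod (f e) \<le> 1" using f unfolding is_state_def by simp
  then have "Re (f e) \<le> 1" using complex_Re_le_cmod order.trans by blast
  ultimately show ?thesis using mult_left_mono[of "Re (f e)" 1 \<kappa>] k0 by simp
qed

text \<open>Any admissible constant is tested on the elements of \<open>A\<close> given by the matrices \<open>a i\<close>.\<close>

lemma C_const_bound: "ereal (sqrt (lam * real CARD('j))) \<le> C_const A I T"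
  unfolding C_const_def
proof (rule Inf_greatest)
  fix t assume "t \<in> {ereal C | C. C > 0 \<and>
     (\<exists>f1 f2. is_state A f1 \<and> is_state A f2 \<and>
       (\<forall>x\<in>carrier A. ell2_norm I (T x) \<le>
          C * Re (f1 (x \<otimes> star A x)) powr (1/4) * Re (f2 (star A x \<otimes> x)) powr (1/4)))}"
  then obtain C f1 f2 where t: "t = ereal C" and C: "C > 0" and f: "is_state A f1" "is_state A f2"
    and le: "\<And>x. x \<in> carrier A \<Longrightarrow> ell2_norm I (T x) \<le>
          C * Re (f1 (x \<otimes> star A x)) powr (1/4) * Re (f2 (star A x \<otimes> x)) powr (1/4)"
    by blast
  have "\<exists>x\<in>carrier A. \<rho> x = a i" if "i \<in> I" for i
    by (rule \<rho>_surj) (use a_off that in auto)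
  then obtain b where b: "\<And>i. i \<in> I \<Longrightarrow> b i \<in> carrier A" "\<And>i. i \<in> I \<Longrightarrow> \<rho> (b i) = a i" by metis
  define P where "P i = Re (f1 (b i \<otimes> star A (b i)))" for i
  define Q where "Q i = Re (f2 (star A (b i) \<otimes> b i))" for i
  \<comment> \<open>Positivity of a state is stated for x^* x, hence it is used at x =
    b_i^*.\<close>
  have P0: "0 \<le> P i" if "i \<in> I" for i
  proof -
    have "star A (star A (b i)) = b i" using b[OF that] by (simp add: \<rho>_inj[symmetric])
    moreover have "star A (b i) \<in> carrier A" using b[OF that] by simp
    ultimately show ?thesis using f(1) unfolding is_state_def P_def by metis
  qed
  have Q0: "0 \<le> Q i" if "i \<in> I" for i
    using f(2) b(1)[OF that] unfolding is_state_def Q_def by blast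
  \<comment> \<open>By orthogonality T maps b_i to lam times the i-th basis vector.\<close>
  have T: "ell2_norm I (T (b i)) = lam" if i: "i \<in> I" for i
  proof -
    have "(\<Sum>i'\<in>I. (cmod (T (b i) i'))\<^sup>2) = (\<Sum>i'\<in>I. if i' = i then lam\<^sup>2 else 0)"
      by (intro sum.cong refl) (use lam_pos in \<open>simp add: T_def b i orth\<close>)
    then show ?thesis using finI i lam_pos by (simp add: ell2_norm_def)
  qed
  \<comment> \<open>Squaring the admissibility inequality leaves sqrt (P_i Q_i), which is replaced
    by the arithmetic mean so that it can be summed over i.\<close>
  have "lam\<^sup>2 \<le> C\<^sup>2 * ((P i + Q i) / 2)" if i: "i \<in> I" for i
  proof -
    have sq: "(z powr (1/4))\<^sup>2 = sqrt z" if "0 \<le> z" for z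
      using that by (simp add: power2_eq_square powr_add[symmetric] powr_half_sqrt)
    have "lam\<^sup>2 \<le> (C * P i powr (1/4) * Q i powr (1/4))\<^sup>2"
      using le[OF b(1)[OF i]] lam_pos unfolding T[OF i] P_def Q_def by (intro power_mono) auto
    also have "\<dots> = C\<^sup>2 * sqrt (P i * Q i)"
      unfolding power_mult_distrib sq[OF P0[OF i]] sq[OF Q0[OF i]] by (simp add: real_sqrt_mult)
    also have "\<dots> \<le> C\<^sup>2 * ((P i + Q i) / 2)"
      by (intro mult_left_mono arith_geo_mean_sqrt P0 Q0 i) auto
    finally show ?thesis .
  qed
  then have "(\<Sum>i\<in>I. lam\<^sup>2) \<le> (\<Sum>i\<in>I. C\<^sup>2 * ((P i + Q i) / 2))" by (rule sum_mono)
  also have "\<dots> = C\<^sup>2 * (((\<Sum>i\<in>I. P i) + (\<Sum>i\<in>I. Q i)) / 2)"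
    by (simp add: sum_distrib_left[symmetric] sum_divide_distrib[symmetric] sum.distrib)
  also have "\<dots> \<le> C\<^sup>2 * \<kappa>"
  proof -
    have "(\<Sum>i\<in>I. P i) \<le> \<kappa>" unfolding P_def
      by (rule state_kappa[OF f(1)]) (auto simp: b kappa)
    moreover have "(\<Sum>i\<in>I. Q i) \<le> \<kappa>" unfolding Q_def
      by (rule state_kappa[OF f(2)]) (auto simp: b kappa)
    ultimately show ?thesis by (intro mult_left_mono) auto
  qed
  finally have *: "real (card I) * lam\<^sup>2 \<le> C\<^sup>2 * \<kappa>" by simp
  \<comment> \<open>Multiplication by N and \<open>kappa_card\<close> turn \<kappa> N into lam |I|,
    a positive common factor.\<close>
  have "(lam * real (card I)) * (lam * real CARD('j)) \<le> (lam * real (card I)) * C\<^sup>2"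
  proof -
    have "(lam * real (card I)) * (lam * real CARD('j)) = real (card I) * lam\<^sup>2 * real CARD('j)"
      by (simp add: power2_eq_square)
    also have "\<dots> \<le> C\<^sup>2 * \<kappa> * real CARD('j)" by (rule mult_right_mono[OF *]) simp
    also have "\<dots> = (lam * real (card I)) * C\<^sup>2"
      by (simp only: mult.assoc kappa_card) (simp only: ac_simps)
    finally show ?thesis .
  qed
  moreover have "card I > 0" using finI pI by (auto simp: card_gt_0_iff)
  then have "lam * real (card I) > 0" using lam_pos by simp
  ultimately have "lam * real CARD('j) \<le> C\<^sup>2" by (rule mult_left_le_imp_le)
  then have "sqrt (lam * real CARD('j)) \<le> C" using C by (simp add: real_le_lsqrt)
  then show "ereal (sqrt (lam * real CARD('j))) \<le> t" by (simp add: t)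
qed

lemma cb_norm_less: "cb_norm A I T < C_const A I T"
proof -
  obtain K where "K < lam * real CARD('j)" "cb_norm A I T \<le> ereal (sqrt K)" using cb_norm_bound by blast
  then have "cb_norm A I T < ereal (sqrt (lam * real CARD('j)))"
    by (metis ereal_less_eq(3) not_le order.strict_trans1 real_sqrt_less_iff)
  also have "\<dots> \<le> C_const A I T" by (rule C_const_bound)
  finally show ?thesis .
qed

end

section \<open>The two examples\<close>

lemma scalar_model_matrix_alg:
  "scalar_model (matrix_alg :: (complex ^ 'n::finite ^ 'n) cstar) (\<lambda>_ _. True) (\<lambda>x j k. x $ j $ k)"
proof
  show "bij_betw (\<lambda>x j k. x $ j $ k) (carrier (matrix_alg :: (complex ^ 'n ^ 'n) cstar))
      {m. \<forall>j k. \<not> True \<longrightarrow> m j k = 0}"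
    by (rule bij_betw_byWitness[where f' = "\<lambda>m. \<chi> j k. m j k"]) (auto simp: matrix_alg_def vec_eq_iff)
qed (auto simp: matrix_alg_def matrix_matrix_mult_def intro: equivpI reflpI sympI transpI)

definition diag :: "complex ^ 'n::finite \<Rightarrow> 'n \<Rightarrow> 'n \<Rightarrow> complex" where
  "diag x j k = (if j = k then x $ j else 0)"

lemma inj_diag: "diag x = diag y \<longleftrightarrow> x = y"
  by (metis diag_def vec_eq_iff)

lemma range_diag: "range diag = {m. \<forall>j k. j \<noteq> k \<longrightarrow> m j k = 0}"
proof -
  have "m \<in> range diag" if "\<forall>j k. j \<noteq> k \<longrightarrow> m j k = 0" for m :: "'a \<Rightarrow> 'a \<Rightarrow> complex"
    by (rule range_eqI[of _ _ "\<chi> j. m j j"]) (use that in \<open>auto simp: diag_def fun_eq_iff\<close>)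
  then show ?thesis by (auto simp: diag_def)
qed

lemma diag_simps:
  "diag 0 = (\<lambda>_ _. 0)" "diag (x + y) = (\<lambda>j k. diag x j k + diag y j k)"
  "diag (c *s x) = (\<lambda>j k. c * diag x j k)"
  "diag (\<chi> i. cnj (x $ i)) = (\<lambda>j k. cnj (diag x k j))"
  by (auto simp: diag_def fun_eq_iff)

lemma diag_mult: "diag (x * y) = (\<lambda>j l. \<Sum>k\<in>UNIV. diag x j k * diag y k l)"
proof (intro ext)
  fix j l
  have "diag x j k * diag y k l = (if k = j then diag (x * y) j l else 0)" for k
    by (auto simp: diag_def)
  then show "diag (x * y) j l = (\<Sum>k\<in>UNIV. diag x j k * diag y k l)" by simp
qed

lemma scalar_model_linf_alg: "scalar_model (linf_alg :: (complex ^ 'n::finite) cstar) (=) diag"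
proof
  show "bij_betw diag (carrier (linf_alg :: (complex ^ 'n) cstar)) {m. \<forall>j k. j \<noteq> k \<longrightarrow> m j k = 0}"
    unfolding bij_betw_def range_diag[symmetric] by (auto simp: linf_alg_def inj_on_def inj_diag)
qed (auto simp: linf_alg_def diag_simps diag_mult identity_equivp)

text \<open>The best constant quantifies over algebras carried by a given type, so the
  finite-dimensional l^\<infinity> algebra is transported along an injection into that type.\<close>

definition linf_copy :: "(complex ^ 'n::finite \<Rightarrow> 'u) \<Rightarrow> 'u cstar" where
  "linf_copy h = \<lparr>carrier = range h, monoid.mult = (\<lambda>x y. h (inv_into UNIV h x * inv_into UNIV h y)), one = h 1,
     ring.zero = h 0, add = (\<lambda>x y. h (inv_into UNIV h x + inv_into UNIV h y)), smult = (\<lambda>c x. h (c *s inv_into UNIV h x)),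
     star = (\<lambda>x. h (\<chi> i. cnj (inv_into UNIV h x $ i))),
     nrm = (\<lambda>x. bnorm (\<lambda>j k. fmat_of 1 (\<lambda>_ _. diag (inv_into UNIV h x) j k)))\<rparr>"

lemma scalar_model_linf_copy:
  assumes "inj h"
  shows "scalar_model (linf_copy h) (=) (\<lambda>x. diag (inv_into UNIV h x))"
proof
  show "bij_betw (\<lambda>x. diag (inv_into UNIV h x)) (carrier (linf_copy h)) {m. \<forall>j k. j \<noteq> k \<longrightarrow> m j k = 0}"
    unfolding bij_betw_def range_diag[symmetric]
    using assms by (auto simp: linf_copy_def inj_on_def inj_diag image_image)
qed (use assms in \<open>auto simp: linf_copy_def diag_simps diag_mult identity_equivp\<close>)

lemma cstar_algebra_linf_copy:
  assumes "inj h"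
  shows "cstar_algebra (linf_copy h)"
proof -
  interpret scalar_model "linf_copy h" "(=)" "\<lambda>x. diag (inv_into UNIV h x)"
    by (rule scalar_model_linf_copy[OF assms])
  show ?thesis
    by (rule block_model.model_cstar_algebra[OF block_model_lift1])
       (simp add: linf_copy_def lift1_def[abs_def])
qed

section \<open>The Levi-Civita symbol and antisymmetric 3 x 3 matrices\<close>

definition cross :: "nat \<Rightarrow> 3 \<Rightarrow> 3 \<Rightarrow> complex" where
  "cross i j k = (if (i, j, k) \<in> {(1, 2, 3), (2, 3, 1), (3, 1, 2)} then 1
     else if (i, j, k) \<in> {(1, 3, 2), (2, 1, 3), (3, 2, 1)} then -1 else 0)"

lemma cross_1: "cross (Suc 0) j k = (if j = 2 \<and> k = 3 then 1 else if j = 3 \<and> k = 2 then -1 else 0)"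
  by (auto simp: cross_def)
lemma cross_2: "cross 2 j k = (if j = 3 \<and> k = 1 then 1 else if j = 1 \<and> k = 3 then -1 else 0)"
  by (auto simp: cross_def)
lemma cross_3: "cross 3 j k = (if j = 1 \<and> k = 2 then 1 else if j = 2 \<and> k = 1 then -1 else 0)"
  by (auto simp: cross_def)
lemmas cross_simps = cross_1 cross_2 cross_3

text \<open>Contraction of Levi-Civita symbols gives a_i^* a_i = 1 - E_ii and a_i^* a_j = - E_ji for
  distinct i, j, where E denotes matrix units. The nine products are independent, and the witnesses
  are the resulting coefficient functionals.\<close>

lemma rigid_cross: "rigid_family {1, 2, 3} cross 2 1 2"
proof
  show "dual_coeff {1, 2, 3} cross 1 2 0"
    unfolding dual_coeff_def
    by (rule exI[of _ "\<lambda>k l. if k = 2 \<and> l = 1 then -1 else 0"]) (simp add: sum_3 cross_simps)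
  show "\<exists>c. c \<noteq> 0 \<and> dual_coeff {1, 2, 3} cross 2 2 c"
    unfolding dual_coeff_def
    by (rule exI[of _ "1/2"], rule conjI, simp, rule exI[of _ "\<lambda>k l. if k = l then (if k = 2 then -1/2 else 1/2) else 0"])
       (simp add: sum_3 cross_simps)
  show "\<exists>c. c \<noteq> 0 \<and> dual_coeff {1, 2, 3} (\<lambda>i j k. cnj (cross i k j)) 1 1 c"
    unfolding dual_coeff_def
    by (rule exI[of _ "1/2"], rule conjI, simp, rule exI[of _ "\<lambda>k l. if k = l then (if k = 1 then -1/2 else 1/2) else 0"])
       (simp add: sum_3 cross_simps)
qed (auto simp: sum_3 cross_simps)

text \<open>
  The conjugates of the rows of four vectors \<open>(2, 1), (2, -1), (1, 2\<i>), (1, -2\<i>)\<close> in \<open>\<complex>\<^sup>2\<close>. They have equal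
  length, their rows are orthogonal, and their Bloch vectors sum to zero without being coplanar, so
  that the rank one projections onto them span \<open>M\<^sub>2(\<complex>)\<close>.
\<close>

definition tetra :: "'i \<Rightarrow> 'i \<Rightarrow> 'i \<Rightarrow> 4 \<Rightarrow> 4 \<Rightarrow> complex" where
  "tetra p q i j k = (if j = k then
     if i = p then (if j = 1 \<or> j = 2 then 2 else 1)
     else if i = q then (if j = 1 then 1 else if j = 2 then -1 else if j = 3 then - 2 * \<i> else 2 * \<i>)
     else 0 else 0)"

lemma tetra_p: "tetra p q p j k = (if j = k then if j = 1 \<or> j = 2 then 2 else 1 else 0)"
  by (simp add: tetra_def)
lemma tetra_q: "p \<noteq> q \<Longrightarrow> tetra p q q j k =
    (if j = k then if j = 1 then 1 else if j = 2 then -1 else if j = 3 then - 2 * \<i> else 2 * \<i> else 0)"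
  by (simp add: tetra_def)
lemmas tetra_simps = tetra_p tetra_q

text \<open>The diagonals of a_p^* a_p, a_q^* a_q, a_p^* a_q and a_q^* a_p are (4, 4, 1, 1), (1, 1,
  4, 4), (2, -2, -2\<i>, 2\<i>) and (2, -2, 2\<i>, -2\<i>), a basis of \<complex>^4. The witnesses
  are members of the dual basis, and c is the sum of their entries.\<close>

lemma rigid_tetra:
  assumes pq: "p \<noteq> q"
  shows "rigid_family {p, q} (tetra p q) 10 p q"
proof
  show "dual_coeff {p, q} (tetra p q) p q 0"
    unfolding dual_coeff_def
    by (rule exI[of _ "\<lambda>k l. if k = l then if k = 1 then 1/8 else if k = 2 then -1/8 else if k = 3 then \<i>/8 else -\<i>/8 else 0"])
       (use pq in \<open>simp add: sum_4 tetra_simps\<close>)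
  show "\<exists>c. c \<noteq> 0 \<and> dual_coeff {p, q} (tetra p q) q q c"
    unfolding dual_coeff_def
    by (rule exI[of _ "1/5"], rule conjI, simp, rule exI[of _ "\<lambda>k l. if k = l then if k = 1 \<or> k = 2 then -1/30 else 4/30 else 0"])
       (use pq in \<open>simp add: sum_4 tetra_simps\<close>)
  show "\<exists>c. c \<noteq> 0 \<and> dual_coeff {p, q} (\<lambda>i j k. cnj (tetra p q i k j)) p p c"
    unfolding dual_coeff_def
    by (rule exI[of _ "1/5"], rule conjI, simp, rule exI[of _ "\<lambda>k l. if k = l then if k = 1 \<or> k = 2 then 4/30 else -1/30 else 0"])
       (use pq in \<open>simp add: sum_4 tetra_simps\<close>)
qed (use pq in \<open>auto simp: sum_4 tetra_simps\<close>)

section \<open>Both families as instances of the general setting\<close>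

lemma OH_model_cross: "OH_model (matrix_alg :: (complex ^ 3 ^ 3) cstar) (\<lambda>_ _. True) (\<lambda>x j k. x $ j $ k) {1, 2, 3} cross 2 1 2 2"
proof (intro OH_model.intro scalar_model_matrix_alg rigid_cross OH_model_axioms.intro)
  have onorm1: "onorm (\<lambda>v. (mat 1 :: complex ^ 3 ^ 3) *v v) \<le> 1"
    by (rule onorm_bound) auto
  show "\<exists>e\<in>carrier (matrix_alg :: (complex ^ 3 ^ 3) cstar).
      (\<lambda>j k. e $ j $ k) = (\<lambda>j k. if j = k then 1 else 0) \<and> nrm matrix_alg e \<le> 1"
    by (rule bexI[of _ "mat 1"]) (auto simp: matrix_alg_def mat_def fun_eq_iff onorm1[unfolded mat_def])
  show "(\<Sum>i\<in>{1, 2, 3}. \<Sum>k\<in>UNIV. cross i j k * cnj (cross i l k)) = (if j = l then complex_of_real 2 else 0)" for j l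
    using exhaust_3[of j] exhaust_3[of l] by (auto simp: sum_3 cross_simps)
  show "(\<Sum>i\<in>{1, 2, 3}. \<Sum>k\<in>UNIV. cnj (cross i k j) * cross i k l) = (if j = l then complex_of_real 2 else 0)" for j l
    using exhaust_3[of j] exhaust_3[of l] by (auto simp: sum_3 cross_simps)
qed auto

lemma OH_model_tetra:
  assumes "scalar_model A (=) \<rho>" and "p \<noteq> q"
    and "\<exists>e\<in>carrier A. \<rho> e = (\<lambda>j k. if j = k then 1 else 0) \<and> nrm A e \<le> 1"
  shows "OH_model A (=) \<rho> {p, q} (tetra p q) 10 p q 5"
proof (intro OH_model.intro assms rigid_tetra OH_model_axioms.intro)
  show "(\<Sum>i\<in>{p, q}. \<Sum>k\<in>UNIV. tetra p q i j k * cnj (tetra p q i l k)) = (if j = l then complex_of_real 5 else 0)" for j l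
    using exhaust_4[of j] exhaust_4[of l] assms(2) by (auto simp: sum_4 tetra_simps)
  show "(\<Sum>i\<in>{p, q}. \<Sum>k\<in>UNIV. cnj (tetra p q i k j) * tetra p q i k l) = (if j = l then complex_of_real 5 else 0)" for j l
    using exhaust_4[of j] exhaust_4[of l] assms(2) by (auto simp: sum_4 tetra_simps)
qed (use assms(2) in \<open>auto simp: tetra_def\<close>)

lemma linf_alg_unit:
  "\<exists>e\<in>carrier (linf_alg :: (complex ^ 'n::finite) cstar).
     diag e = (\<lambda>j k. if j = k then 1 else 0) \<and> nrm linf_alg e \<le> 1"
  by (rule bexI[of _ 1]) (auto simp: linf_alg_def diag_def fun_eq_iff)

lemma linf_copy_unit:
  assumes "inj h"
  shows "\<exists>e\<in>carrier (linf_copy h).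
     diag (inv_into UNIV h e) = (\<lambda>j k. if j = k then 1 else 0) \<and> nrm (linf_copy h) e \<le> 1"
proof (rule bexI[of _ "h 1"], intro conjI)
  have d: "diag (inv_into UNIV h (h 1)) = (\<lambda>j k. if j = k then 1 else 0)"
    using assms by (auto simp: diag_def fun_eq_iff)
  then show "diag (inv_into UNIV h (h 1)) = (\<lambda>j k. if j = k then 1 else 0)" .
  \<comment> \<open>A block of size 1 acts as left multiplication by the matrix unit in the corner,
    a contraction but not the identity.\<close>
  have "norm (act (\<lambda>j k. fmat_of 1 (\<lambda>_ _. if j = k then 1 else 0)) g) \<le> 1 * norm g" for g :: "fmat ^ 'a"
  proof -
    have e: "fmat_of 1 (\<lambda>_ _. if j = k then 1 else 0) * g $ k = (if k = j then munit 0 0 * g $ k else 0)" for j k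
      by (auto intro!: fmat_eqI arg_cong[where f = "\<lambda>a. a * _"] simp: ent_mult[OF supp_fmat_of])
    have "norm (munit 0 0 * y) \<le> norm y" for y
      using norm_mult_ineq[of "munit 0 0" y] by (simp add: norm_munit)
    then show ?thesis
      unfolding act_def e norm_vec_def by (auto intro!: L2_set_mono)
  qed
  then show "nrm (linf_copy h) (h 1) \<le> 1"
    by (simp add: linf_copy_def d bnorm_le)
qed (simp add: linf_copy_def)

text \<open>An infinite set is equipotent to its square, so a pairing injection exists; it is
  applied twice.\<close>

lemma inj_complex4: "\<exists>h :: complex ^ 4 \<Rightarrow> complex. inj h"
proof -
  have "infinite (UNIV :: complex set)" by (rule infinite_UNIV_char_0)
  from card_of_Times_same_infinite[OF this]
  have "(card_of (UNIV :: (complex \<times> complex) set), card_of (UNIV :: complex set)) \<in> ordLeq"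
    by (simp add: ordIso_imp_ordLeq)
  then obtain f :: "complex \<times> complex \<Rightarrow> complex" where f: "inj f"
    unfolding card_of_ordLeq[symmetric] by auto
  have "inj (\<lambda>x :: complex ^ 4. f (f (x $ 1, x $ 2), f (x $ 3, x $ 4)))"
  proof (rule injI)
    fix x y :: "complex ^ 4"
    assume "f (f (x $ 1, x $ 2), f (x $ 3, x $ 4)) = f (f (y $ 1, y $ 2), f (y $ 3, y $ 4))"
    then have "x $ 1 = y $ 1" "x $ 2 = y $ 2" "x $ 3 = y $ 3" "x $ 4 = y $ 4"
      using f by (auto simp: inj_eq)
    then show "x = y" by (simp add: vec_eq_iff forall_4)
  qed
  then show ?thesis by blast
qed

section \<open>From a strict inequality for one map to the best constant\<close>

lemma (in OH_model) best_constant_gt_1: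
  assumes "cstar_algebra A"
  shows "1 < best_constant TYPE('a) TYPE('i)"
proof -
  define s where "s = sqrt (lam * real CARD('j))"
  obtain K where K: "0 \<le> K" "K < lam * real CARD('j)" and cb: "cb_norm A I T \<le> ereal (sqrt K)"
    using cb_norm_bound by blast
  \<comment> \<open>The midpoint lies strictly below s and is positive even if K = 0, so it is an
    upper bound for the cb-norm by which one can divide.\<close>
  define k where "k = (sqrt K + s) / 2"
  have "2 * k = sqrt K + s" by (simp add: k_def)
  moreover have "sqrt K < s" "0 \<le> sqrt K" using K by (auto simp: s_def)
  ultimately have k: "sqrt K \<le> k" "0 < k" "k < s" by linarith+
  have nontriv: "carrier A \<noteq> {\<zero>}"
  proof
    \<comment> \<open>The zero element has the zero matrix as its image, whereas A contains the
      identity matrix.\<close>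
    assume A: "carrier A = {\<zero>}"
    obtain e where "e \<in> carrier A" "\<rho> e = (\<lambda>j k. if j = k then 1 else 0)" using unit by blast
    then have "(\<lambda>j k :: 'j. if j = k then 1 else 0 :: complex) = (\<lambda>_ _. 0)" using A by simp
    then have "(if undefined = (undefined :: 'j) then 1 else 0 :: complex) = 0" by meson
    then show False by simp
  qed
  have T: "cb_to_OH A I T"
    using T_linear cb by (auto simp: cb_to_OH_def)
  have "ereal (s / k) \<le> best_constant TYPE('a) TYPE('i)"
    unfolding best_constant_def
  proof (rule Inf_greatest)
    fix t assume "t \<in> {ereal C | C. C \<ge> 0 \<and>
     (\<forall>(A :: 'a cstar) (I :: 'i set) T.
        cstar_algebra A \<and> carrier A \<noteq> {\<zero>\<^bsub>A\<^esub>} \<and> cb_to_OH A I T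
        \<longrightarrow> C_const A I T \<le> ereal C * cb_norm A I T)}"
    then obtain C where C: "t = ereal C" "C \<ge> 0" and le: "C_const A I T \<le> ereal C * cb_norm A I T"
      using assms nontriv T by blast
    have "ereal s \<le> C_const A I T" unfolding s_def by (rule C_const_bound)
    also note le
    also have "ereal C * cb_norm A I T \<le> ereal C * ereal k"
      using C(2) k(1) cb by (intro ereal_mult_left_mono) (auto intro: order.trans)
    finally have "s \<le> C * k" by simp
    then show "ereal (s / k) \<le> t" using k C by (simp add: field_simps)
  qed
  moreover have "1 < ereal (s / k)" using k by simp
  ultimately show ?thesis by (rule order.strict_trans2[rotated])
qed

theorem theorem7p2:
  shows "(\<exists>T1 :: complex^3^3 \<Rightarrow> nat \<Rightarrow> complex.
            linear_to_OH matrix_alg {1, 2, 3} T1 \<and>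
            cb_norm matrix_alg {1, 2, 3} T1 < C_const matrix_alg {1, 2, 3} T1) \<and>
         (\<exists>T2 :: complex^4 \<Rightarrow> nat \<Rightarrow> complex.
            linear_to_OH linf_alg {1, 2} T2 \<and>
            cb_norm linf_alg {1, 2} T2 < C_const linf_alg {1, 2} T2) \<and>
         ((\<exists>g :: complex \<Rightarrow> 'u. inj g) \<and> infinite (UNIV :: 'i set)
            \<longrightarrow> 1 < best_constant TYPE('u) TYPE('i))"
proof (intro conjI impI)
  show "\<exists>T1 :: complex^3^3 \<Rightarrow> nat \<Rightarrow> complex. linear_to_OH matrix_alg {1, 2, 3} T1 \<and>
      cb_norm matrix_alg {1, 2, 3} T1 < C_const matrix_alg {1, 2, 3} T1"
    using OH_model.T_linear[OF OH_model_cross] OH_model.cb_norm_less[OF OH_model_cross] by blast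
  have *: "OH_model (linf_alg :: (complex ^ 4) cstar) (=) diag {1 :: nat, 2} (tetra 1 2) 10 1 2 5"
    by (rule OH_model_tetra[OF scalar_model_linf_alg _ linf_alg_unit]) simp
  show "\<exists>T2 :: complex^4 \<Rightarrow> nat \<Rightarrow> complex. linear_to_OH linf_alg {1, 2} T2 \<and>
      cb_norm linf_alg {1, 2} T2 < C_const linf_alg {1, 2} T2"
    using OH_model.T_linear[OF *] OH_model.cb_norm_less[OF *] by blast
  assume "(\<exists>g :: complex \<Rightarrow> 'u. inj g) \<and> infinite (UNIV :: 'i set)"
  then obtain g :: "complex \<Rightarrow> 'u" where g: "inj g" and inf: "infinite (UNIV :: 'i set)" by blast
  obtain h :: "complex ^ 4 \<Rightarrow> complex" where "inj h" using inj_complex4 by blast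
  with g have gh: "inj (g \<circ> h)" by (intro inj_compose)
  \<comment> \<open>Any two distinct indices carry the two coordinates of the second
    example.\<close>
  obtain p q :: 'i where pq: "p \<noteq> q" using inf by (metis (full_types) UNIV_I finite.simps insert_iff finite_subset subsetI)
  show "1 < best_constant TYPE('u) TYPE('i)"
    by (rule OH_model.best_constant_gt_1[OF OH_model_tetra[OF scalar_model_linf_copy[OF gh] pq linf_copy_unit[OF gh]]
        cstar_algebra_linf_copy[OF gh]])
qed

end
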